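(* Let $R\geq 4$ be an even integer and, for each integer $l\geq1$, let $\alpha_l\in(0,1)$ be the number whose negative continued fraction expansion is periodic with period block consisting of $R+1$ followed by $l$ copies of $R$, i.e. $\alpha_l=[0;\overline{R+1,R,\ldots,R}]^-$. Then $$\lim_{l\to\infty}\rho(\alpha_l)=C(R):=\frac{(1-2\delta)(1-\beta)}{4(1-\delta\beta)}=\frac14\cdot\frac{R-2}{\sqrt{R^2-4}+1},$$ where $\beta=\frac12(R-\sqrt{R^2-4})$ and $\delta=\frac{1}{R+1-\beta}$.
   Context: For real $x$, $\|x\|$ denotes the distance from $x$ to the nearest integer. For irrational $\alpha$ and real $\gamma$, $M(\alpha,\gamma):=\liminf_{|n|\to\infty}|n|\,\|n\alpha-\gamma\|$, and $\rho(\alpha):=\sup_{\gamma\notin\mathbb{Z}+\alpha\mathbb{Z}}M(\alpha,\gamma)$. The negative continued fraction expansion $[0;a_1,a_2,\ldots]^-$ means $\alpha=\cfrac{1}{a_1-\cfrac{1}{a_2-\cdots}}$ with integers $a_i\geq2$ generated by $\alpha_0=\alpha$, $a_{n+1}=\lceil 1/\alpha_n\rceil$, $\alpha_{n+1}=\lceil1/\alpha_n\rceil-1/\alpha_n$; an overline denotes a repeating block. *)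

theory Defs
  imports "HOL-Analysis.Analysis" "HOL-Library.Extended_Real" "HOL-Library.Liminf_Limsup"
begin

definition nint_dist :: "real \<Rightarrow> real" where
  "nint_dist x = min (frac x) (1 - frac x)"

text \<open>M(alpha,gamma) = liminf over abs n to infinity (n integer) of abs n times the
  distance of n alpha - gamma to the nearest integer.  The filter "abs n tends to infinity"
  on the integers is the cofinite filter.  Values are taken in the extended reals.\<close>
definition M_inhom :: "real \<Rightarrow> real \<Rightarrow> ereal" where
  "M_inhom \<alpha> \<gamma> =
     Liminf cofinite (\<lambda>n::int. ereal (\<bar>real_of_int n\<bar> * nint_dist (real_of_int n * \<alpha> - \<gamma>)))"

definition rho :: "real \<Rightarrow> ereal" where
  "rho \<alpha> = (SUP \<gamma> \<in> {\<gamma>. \<not> (\<exists>m k::int. \<gamma> = real_of_int m + \<alpha> * real_of_int k)}. M_inhom \<alpha> \<gamma>)"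

fun ncf_rem :: "real \<Rightarrow> nat \<Rightarrow> real" where
  "ncf_rem x 0 = x"
| "ncf_rem x (Suc n) = real_of_int \<lceil>1 / ncf_rem x n\<rceil> - 1 / ncf_rem x n"

text \<open>ncf_digit x n is the digit a_{n+1} = ceil(1/alpha_n) (so digits are indexed from 0).\<close>
definition ncf_digit :: "real \<Rightarrow> nat \<Rightarrow> int" where
  "ncf_digit x n = \<lceil>1 / ncf_rem x n\<rceil>"

end

(* The points (n, n \<alpha> - m - \<gamma>) form a shifted lattice with basis V_N = (q_N, D_N), V_(N+1), and
   |n| |n \<alpha> - m - \<gamma>| is the product |x y| of the coordinates.  At the positions N where the digit R + 1
   occurs, the lattice, rescaled so that V_N = (1, 1), tends to the lattice spanned by (1, 1) and
   (1 + 1 / \<beta>, \<beta>) as l grows, so the upper bound amounts to a covering statement: every shift of this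
   limit lattice has a point with |x y| at most (R - 2) / 4 + \<epsilon>.  In the coordinates s = x + y, d = x - y
   the rows d = const with 4 d^2 <= R^2 - 4 are dealt with directly; any other shift is described by two
   small parameters X, Y, and a parameter that is not negligible is expanded by the hyperbolic structure
   until a corner of a far cell has a small product.  What remains is X, Y nearly 0, the extremal shift.
   For the lower bound, \<gamma> is chosen with digit 1 at every partial quotient R + 1 and digit 0 at every R.
   In each quadrant with x y < 0 the points then lie beyond a polygonal line with vertices at the corners
   of the cells, so that |x y| is at least its smallest value at a corner. *)

theory Submission
  imports Defs
begin

section \<open>Coverings by translates of the limit lattice\<close>

text \<open>\<open>b\<close> is beta of the theorem: the fixed point in (0, 1) of the map t -> 1 /
  (R - t), which governs long blocks of the digit \<open>R\<close>.\<close>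

locale quad_root =
  fixes R :: int and b :: real
  assumes R4: "R \<ge> 4" and even_R: "even R"
    and b_pos: "0 < b" and b_less: "b < 1" and b_eq: "b * (R - b) = 1"
begin

section \<open>Identities for the quadratic root and the limit lattice\<close>

definition lam :: real where "lam = 1 + 1 / b"

lemma R4': "real_of_int R \<ge> 4"
  using R4 by linarith

lemma inv_b: "1 / b = R - b"
  using b_pos b_eq by (simp add: field_simps)

lemma lam_eq: "lam = R + 1 - b"
  using inv_b by (simp add: lam_def)

lemma R_eq: "real_of_int R = b + 1 / b"
  using inv_b by simp

lemma b_le: "b \<le> 7/25"
proof (rule ccontr)
  assume *: "\<not> ?thesis"
  then have "(7/25) * (4 - b) < b * (4 - b)" using b_less by (intro mult_strict_right_mono) auto
  moreover have "b * (4 - b) \<le> 1"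
    using R4' b_pos unfolding b_eq[symmetric] by (intro mult_left_mono) auto
  moreover have "(b - 7/25) * (1 - b) \<ge> 0" using b_less * by (intro mult_nonneg_nonneg) simp_all
  ultimately show False using * by (simp add: field_simps)
qed

lemma delta_eq: "1 / (R + 1 - b) = b / (1 + b)"
proof -
  have "R + 1 - b = (1 + b) / b" unfolding of_int_add R_eq using b_pos by (simp add: field_simps)
  then show ?thesis by simp
qed

lemma R_minus_2: "(1 - b)\<^sup>2 / b = R - 2"
  using b_pos by (simp add: R_eq field_simps power2_eq_square)

text \<open>This concerns a shift of the limit lattice spanned by (1, 1) and (\<open>lam\<close>,
  \<open>b\<close>). The bound \<open>M\<close> is carried along so that the covering survives a
  small perturbation of the basis.\<close>

definition good :: "real \<Rightarrow> real \<Rightarrow> real \<Rightarrow> real \<Rightarrow> bool" where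
  "good c M x y \<longleftrightarrow> (\<exists>(i::int) (j::int). \<bar>(x + i + j * lam) * (y + i + j * b)\<bar> \<le> c
     \<and> \<bar>x + i + j * lam\<bar> \<le> M \<and> \<bar>y + i + j * b\<bar> \<le> M)"

lemma goodI0: "\<bar>x * y\<bar> \<le> c \<Longrightarrow> \<bar>x\<bar> \<le> M \<Longrightarrow> \<bar>y\<bar> \<le> M \<Longrightarrow> good c M x y"
  unfolding good_def by (rule exI[of _ 0], rule exI[of _ 0]) simp

lemma good_shift:
  assumes "good c M (x + of_int i + of_int j * lam) (y + of_int i + of_int j * b)"
  shows "good c M x y"
proof -
  obtain i' j' :: int where
    *: "\<bar>(x + i + j * lam + i' + j' * lam) * (y + i + j * b + i' + j' * b)\<bar> \<le> c"
       "\<bar>x + i + j * lam + i' + j' * lam\<bar> \<le> M" "\<bar>y + i + j * b + i' + j' * b\<bar> \<le> M"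
    using assms unfolding good_def by blast
  show ?thesis unfolding good_def
    by (rule exI[of _ "i + i'"], rule exI[of _ "j + j'"]) (use * in \<open>simp add: algebra_simps\<close>)
qed

lemma good_neg:
  assumes "good c M (- x) (- y)"
  shows "good c M x y"
proof -
  obtain i j :: int where
    *: "\<bar>(- x + i + j * lam) * (- y + i + j * b)\<bar> \<le> c"
       "\<bar>- x + i + j * lam\<bar> \<le> M" "\<bar>- y + i + j * b\<bar> \<le> M"
    using assms unfolding good_def by blast
  have "x + real_of_int (- i) + real_of_int (- j) * lam = - (- x + i + j * lam)"
    "y + real_of_int (- i) + real_of_int (- j) * b = - (- y + i + j * b)" by auto
  then show ?thesis using * unfolding good_def
    by (metis abs_minus_cancel minus_mult_minus)
qed

text \<open>Since \<open>lam + b = R + 1\<close>, the vector (\<open>b\<close>, \<open>lam\<close>)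
  equals R + 1 times (1, 1) minus (\<open>lam\<close>, \<open>b\<close>), so the lattice is
  symmetric about the diagonal.\<close>

lemma good_swap:
  assumes "good c M y x"
  shows "good c M x y"
proof -
  obtain i j :: int where
    *: "\<bar>(y + i + j * lam) * (x + i + j * b)\<bar> \<le> c"
       "\<bar>y + i + j * lam\<bar> \<le> M" "\<bar>x + i + j * b\<bar> \<le> M"
    using assms unfolding good_def by blast
  have "x + real_of_int (i + j * (R + 1)) + real_of_int (- j) * lam = x + i + j * b"
    "y + real_of_int (i + j * (R + 1)) + real_of_int (- j) * b = y + i + j * lam"
    by (simp_all add: lam_eq algebra_simps)
  then show ?thesis using * unfolding good_def
    by (metis mult.commute)
qed

text \<open>With s = x + y and d = x - y the product is (s^2 - d^2) / 4, and adding (1, 1) moves s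
  by 2 while d stays. So some s in the given class modulo 2 with |s^2 - d^2| at most R - 2 is
  enough.\<close>

lemma good_row:
  assumes d: "4 * (x - y)\<^sup>2 \<le> (real_of_int R)\<^sup>2 - 4" and c: "c \<ge> (R - 2) / 4" and M: "M \<ge> real_of_int R"
  shows "good c M x y"
proof -
  define w m :: int where "w = R - 2" and "m = R div 2 - 1"
  have w: "w = 2 * m" "m \<ge> 1" "R = 2 * m + 2" using even_R R4 by (auto simp: w_def m_def)
  define d where "d = x - y"
  have d2: "d\<^sup>2 \<le> m\<^sup>2 + w"
    using assms w by (simp add: d_def power2_eq_square algebra_simps)
  \<comment> \<open>Every |s| in [j, j + 1] is then admissible. The least j with the lower condition
    also satisfies the upper one, because it is at most the integer \<open>m\<close>.\<close>
  have "\<exists>j::int. 0 \<le> j \<and> j \<le> m \<and> d\<^sup>2 \<le> j\<^sup>2 + w \<and> (j + 1)\<^sup>2 \<le> d\<^sup>2 + w"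
  proof -
    have "\<exists>j::nat. d\<^sup>2 \<le> (real j)\<^sup>2 + w"
      using d2 w by (intro exI[of _ "nat m"]) auto
    then obtain j :: nat where j: "d\<^sup>2 \<le> (real j)\<^sup>2 + w" and least: "\<And>i. i < j \<Longrightarrow> \<not> d\<^sup>2 \<le> (real i)\<^sup>2 + w"
      using exists_least_iff[of "\<lambda>j::nat. d\<^sup>2 \<le> (real j)\<^sup>2 + w"] by auto
    have jm: "int j \<le> m"
    proof (rule ccontr)
      assume "\<not> ?thesis" then have "nat m < j" using w(2) by linarith
      from least[OF this] d2 w show False by auto
    qed
    have "(real j + 1)\<^sup>2 \<le> d\<^sup>2 + w"
    proof (cases j)
      case 0
      then show ?thesis using w by (simp add: add_increasing)
    next
      case (Suc i)
      then have "(real i)\<^sup>2 + w < d\<^sup>2" using least[of i] by simp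
      moreover have "real i + 1 \<le> m" using jm Suc by linarith
      ultimately show ?thesis using w Suc by (simp add: power2_eq_square algebra_simps)
    qed
    then show ?thesis using j jm by (intro exI[of _ "int j"]) auto
  qed
  then obtain j :: int where j: "0 \<le> j" "j \<le> m" "d\<^sup>2 \<le> j\<^sup>2 + w" "(j + 1)\<^sup>2 \<le> d\<^sup>2 + w" by blast
  \<comment> \<open>The intervals [j, j + 1] and [-j - 1, -j] together meet every class modulo 2:
    the second, moved by 2 j + 2, continues the first.\<close>
  have "\<exists>i::int. j \<le> \<bar>x + y + 2 * i\<bar> \<and> \<bar>x + y + 2 * i\<bar> \<le> j + 1"
  proof -
    define f where "f = \<lfloor>(x + y - j) / 2\<rfloor>"
    have "of_int f \<le> (x + y - j) / 2" "(x + y - j) / 2 < of_int f + 1"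
      unfolding f_def by (rule of_int_floor_le, rule real_of_int_floor_add_one_gt)
    then have f: "2 * real_of_int f \<le> x + y - j" "x + y - j < 2 * real_of_int f + 2" by simp_all
    show ?thesis
    proof (cases "x + y - 2 * real_of_int f \<le> j + 1")
      case True
      then show ?thesis using f j by (intro exI[of _ "- f"]) auto
    next
      case False
      then show ?thesis using f j by (intro exI[of _ "- f - j - 1"]) auto
    qed
  qed
  then obtain i :: int where i: "j \<le> \<bar>x + y + 2 * i\<bar>" "\<bar>x + y + 2 * i\<bar> \<le> j + 1" by blast
  define s where "s = x + y + 2 * i"
  have "j\<^sup>2 \<le> s\<^sup>2" "s\<^sup>2 \<le> (real_of_int j + 1)\<^sup>2"
    using i j power_mono[of "real_of_int j" "\<bar>s\<bar>" 2] power_mono[of "\<bar>s\<bar>" "real_of_int j + 1" 2]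
    by (auto simp: s_def)
  then have sd: "\<bar>s\<^sup>2 - d\<^sup>2\<bar> \<le> w" using j by auto
  have xy: "x + i = (s + d) / 2" "y + i = (s - d) / 2" by (auto simp: s_def d_def field_simps)
  have "(x + i) * (y + i) = (s\<^sup>2 - d\<^sup>2) / 4" unfolding xy by (simp add: power2_eq_square field_simps)
  then have "\<bar>(x + i) * (y + i)\<bar> \<le> c" using sd c by (simp add: w_def)
  moreover have "\<bar>s\<bar> \<le> R" using i j w by (simp add: s_def)
  moreover have "\<bar>d\<bar> \<le> R"
  proof -
    have "d\<^sup>2 \<le> (real_of_int R)\<^sup>2" using d by (simp add: d_def) (use zero_le_power2[of "x - y"] in linarith)
    then show ?thesis using R4' abs_le_square_iff[of d "real_of_int R"] by simp
  qed
  ultimately show ?thesis using M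
    by (intro good_shift[of c M x i 0 y] goodI0) (auto simp: xy)
qed

section \<open>Lattice vectors from the hyperbolic structure, and far corners\<close>

lemma pow2_suc: "b ^ (2 * k) = b ^ k * b ^ k" for k
  by (simp add: mult_2 power_add)

text \<open>The lattice vectors are \<open>(Vx k, b ^ k)\<close>, with \<open>k = 0, 1\<close> giving the basis, and
  \<open>(Delta k, - (1 - b) * b ^ k)\<close> is the difference of the vectors with indices \<open>k + 1\<close> and \<open>k\<close>.\<close>

definition Vx :: "nat \<Rightarrow> real" where "Vx k = ((1 + b - b\<^sup>2) / b ^ k - b * b ^ k) / (1 - b\<^sup>2)"
definition Delta :: "nat \<Rightarrow> real" where "Delta k = (1 + b - b\<^sup>2 + b ^ (2 * k + 2)) / ((1 + b) * b ^ Suc k)"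

lemma b_ne: "b \<noteq> 0" "1 + b \<noteq> 0" "1 - b \<noteq> 0" "1 - b\<^sup>2 \<noteq> 0" "1 - b\<^sup>2 = (1 - b) * (1 + b)" "b * b \<noteq> 1"
  using b_pos b_less by (auto simp: power2_eq_square algebra_simps mult_eq_1)

text \<open>Both \<open>b ^ k\<close> and its inverse satisfy the recursion, because
  \<open>b + 1 / b = R\<close>.\<close>

lemma Vx_rec: "Vx (Suc (Suc k)) = R * Vx (Suc k) - Vx k"
proof -
  have *: "u / (b * (b * x)) - b * (b * (b * x)) = (b + 1 / b) * (u / (b * x) - b * (b * x)) - (u / x - b * x)"
    if "x \<noteq> 0" for u x using that b_ne(1) by (simp add: field_simps)
  show ?thesis
    using *[of "b ^ k" "1 + b - b\<^sup>2"] b_ne(1)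
    by (simp add: Vx_def R_eq diff_divide_distrib[symmetric] del: times_divide_eq_left)
qed

lemma Vx_0: "Vx 0 = 1" and Vx_1: "Vx (Suc 0) = lam"
proof -
  show "Vx 0 = 1" using b_ne(4) by (simp add: Vx_def)
  have "(1 + b - b\<^sup>2) / b - b * b = (1 + 1 / b) * (1 - b\<^sup>2)"
    using b_ne(1) by (simp add: field_simps power2_eq_square)
  then show "Vx (Suc 0) = lam" using b_ne(4) by (simp add: Vx_def lam_def)
qed

lemma Delta_0: "Delta 0 = 1 / b"
proof -
  have "1 + b - b\<^sup>2 + b ^ (2 * 0 + 2) = 1 + b" by (simp add: power2_eq_square)
  then show ?thesis using b_ne(2) unfolding Delta_def by simp
qed

lemma Delta_Suc: "Delta (Suc k) = Delta k + (R - 2) * Vx (Suc k)"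
proof -
  define x where "x = b ^ k"
  have x: "x \<noteq> 0" using b_ne by (simp add: x_def)
  have 1: "Delta (Suc k) * (1 - b\<^sup>2) = (1 - b) * ((1 + b - b\<^sup>2) / (b * b * x) + b * b * x)"
    using x b_ne by (simp add: Delta_def b_ne(5) pow2_suc flip: x_def)
      (simp add: field_simps power2_eq_square)
  have 2: "Delta k * (1 - b\<^sup>2) = (1 - b) * ((1 + b - b\<^sup>2) / (b * x) + b * x)"
    using x b_ne by (simp add: Delta_def b_ne(5) pow2_suc flip: x_def)
      (simp add: field_simps power2_eq_square)
  have 3: "Vx (Suc k) * (1 - b\<^sup>2) = (1 + b - b\<^sup>2) / (b * x) - b * b * x"
    using x b_ne by (simp add: Vx_def flip: x_def)
  have "Delta (Suc k) * (1 - b\<^sup>2) = (Delta k + (R - 2) * Vx (Suc k)) * (1 - b\<^sup>2)"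
    unfolding distrib_right mult.assoc 1 2 3 R_minus_2[symmetric]
    using x b_ne(1) by (simp add: field_simps power2_eq_square)
  then show ?thesis using b_ne by simp
qed

definition lat :: "real \<Rightarrow> real \<Rightarrow> bool" where
  "lat u v \<longleftrightarrow> (\<exists>(i::int) (j::int). u = i + j * lam \<and> v = i + j * b)"

lemma lat_comb: "lat u v \<Longrightarrow> lat u' v' \<Longrightarrow> lat (of_int m * u + of_int n * u') (of_int m * v + of_int n * v')"
proof -
  assume "lat u v" "lat u' v'"
  then obtain i j i' j' :: int where
    "u = i + j * lam" "v = i + j * b" "u' = i' + j' * lam" "v' = i' + j' * b"
    unfolding lat_def by blast
  then show ?thesis unfolding lat_def
    by (intro exI[of _ "m * i + n * i'"] exI[of _ "m * j + n * j'"]) (simp add: algebra_simps)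
qed

lemma good_lat: "lat u v \<Longrightarrow> good c M (x + u) (y + v) \<Longrightarrow> good c M x y"
  unfolding lat_def using good_shift by (metis add.assoc)

lemma lat_V: "lat (Vx k) (b ^ k) \<and> lat (Vx (Suc k)) (b ^ Suc k)"
proof (induction k)
  case 0
  show ?case unfolding lat_def Vx_0 Vx_1
    by (intro conjI, rule exI[of _ 1], rule exI[of _ 0], simp, rule exI[of _ 0], rule exI[of _ 1], simp)
next
  case (Suc k)
  have "b ^ Suc (Suc k) = of_int R * b ^ Suc k + of_int (-1) * b ^ k"
    using b_ne by (simp add: R_eq field_simps)
  then have "lat (Vx (Suc (Suc k))) (b ^ Suc (Suc k))"
    using lat_comb[of "Vx (Suc k)" "b ^ Suc k" "Vx k" "b ^ k" R "-1"] Suc by (simp add: Vx_rec)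
  then show ?case using Suc by simp
qed

text \<open>Consecutive difference vectors differ by R - 2 times a lattice vector, and R is even, so
  half the difference between the vectors of index \<open>k\<close> and 0 is again in the lattice.
  Adding it moves the initial corner to a far one within the same shift.\<close>

lemma lat_Delta: "lat ((Delta k - 1 / b) / 2) (- (1 - b) * (b ^ k - 1) / 2)"
proof (induction k)
  case 0
  show ?case unfolding lat_def by (rule exI[of _ 0], rule exI[of _ 0]) (simp add: Delta_0)
next
  case (Suc k)
  obtain m where m: "R = 2 * m" using even_R by blast
  have 1: "(Delta (Suc k) - 1 / b) / 2 = of_int 1 * ((Delta k - 1 / b) / 2) + of_int (m - 1) * Vx (Suc k)"
    by (simp add: Delta_Suc m algebra_simps add_divide_distrib diff_divide_distrib)
  have "real_of_int (m - 1) = (1 - b)\<^sup>2 / b / 2" unfolding R_minus_2 by (simp add: m)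
  then have m: "real_of_int (m - 1) * b = (1 - b)\<^sup>2 / 2" using b_ne(1) by simp
  have 2: "- (1 - b) * (b ^ Suc k - 1) / 2 = of_int 1 * (- (1 - b) * (b ^ k - 1) / 2) + of_int (m - 1) * b ^ Suc k"
    unfolding power_Suc mult.assoc[symmetric] m by (simp add: field_simps power2_eq_square)
  show ?case unfolding 1 2 using Suc lat_V by (intro lat_comb) auto
qed

lemma Delta_le: "Delta k * b ^ Suc k \<le> 1"
proof -
  have "b ^ (2 * k + 2) \<le> b\<^sup>2" using b_pos b_less by (intro power_decreasing) auto
  then have "(1 + b - b\<^sup>2 + b ^ (2 * k + 2)) / (1 + b) \<le> 1" using b_pos by simp
  then show ?thesis using b_ne by (simp add: Delta_def)
qed

lemma Delta_ge: "Delta k \<ge> 3"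
proof -
  have V: "Vx (Suc k) \<ge> 0" for k
  proof -
    have 1: "b\<^sup>2 \<le> b" using b_pos b_less by (simp add: power2_eq_square mult_left_le)
    have "b ^ Suc k \<le> 1" "0 < b ^ Suc k" using b_pos b_less by (auto simp del: power_Suc intro: power_le_one)
    then have "1 \<le> (1 + b - b\<^sup>2) / b ^ Suc k" "b * b ^ Suc k \<le> 1 * 1"
      using 1 b_less b_pos by (auto simp: le_divide_eq simp del: power_Suc) (intro mult_mono[of b 1 _ 1, simplified]; simp del: power_Suc)
    moreover have "b\<^sup>2 < 1" using 1 b_less by simp
    ultimately show ?thesis by (simp add: Vx_def del: power_Suc)
  qed
  have "Delta k \<ge> 1 / b"
  proof (induction k)
    case (Suc k)
    then show ?case using V[of k] R4' by (simp add: Delta_Suc add_increasing2)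
  qed (simp add: Delta_0)
  then show ?thesis using inv_b R4' b_less by linarith
qed


text \<open>The corner with index \<open>k\<close> serves the band from \<open>T * b ^ (k + 1)\<close> to \<open>T * b ^ k\<close>; these bands tile \<open>(0, T]\<close>.\<close>

definition T :: real where "T = 2 * (1 - b) / (1 + b)"

lemma T_ge: "T \<ge> 11/10"
  using b_le b_pos by (auto simp: T_def field_simps)

text \<open>For \<open>y\<close> in band \<open>k\<close> the product of the doubled coordinates is
  at most \<open>(Delta k + 1) * h\<close> up to \<open>e\<close>-terms. This is at most
  \<open>(1 - b)\<^sup>2 / b = R - 2\<close>, because \<open>Delta k * b ^ Suc k \<le> 1\<close>.
  Keeping \<open>k \<le> K\<close> makes the coordinate bounds uniform.\<close>

lemma far_corner:
  fixes y u e :: real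
  assumes y: "0 < y" "y \<le> T" "T * b ^ K \<le> y" and e: "e \<ge> 0" "e \<le> 1"
    and u: "-2 \<le> u" "u \<le> 1 + e"
  shows "\<exists>k\<le>K. \<bar>(u + Delta k) / 2 * ((y - (1 - b) * b ^ k) / 2)\<bar> \<le> (R - 2) / 4 + e
    \<and> \<bar>(u + Delta k) / 2\<bar> \<le> 2 + 1 / b ^ Suc K \<and> \<bar>(y - (1 - b) * b ^ k) / 2\<bar> \<le> 2"
proof -
  have "\<exists>k. k \<le> K \<and> T * b ^ Suc k \<le> y \<and> y \<le> T * b ^ k"
  proof -
    define k where "k = (LEAST k. T * b ^ Suc k \<le> y)"
    have ex: "T * b ^ Suc K \<le> y"
    proof -
      have "T * b ^ Suc K \<le> T * b ^ K"
        using b_pos b_less T_ge by (intro mult_left_mono power_decreasing) auto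
      then show ?thesis using y(3) by simp
    qed
    have 1: "T * b ^ Suc k \<le> y" unfolding k_def by (rule LeastI[of _ K]) (rule ex)
    have 2: "k \<le> K" unfolding k_def by (rule Least_le) (rule ex)
    have "y \<le> T * b ^ k"
    proof (cases k)
      case (Suc i)
      have "i < (LEAST k. T * b ^ Suc k \<le> y)" using Suc unfolding k_def[symmetric] by simp
      from not_less_Least[OF this] show ?thesis unfolding Suc by linarith
    qed (use y in simp)
    with 1 2 show ?thesis by blast
  qed
  then obtain k where k: "k \<le> K" "T * b ^ Suc k \<le> y" "y \<le> T * b ^ k" by blast
  have p: "0 < b ^ k" using b_pos by simp
  \<comment> \<open>\<open>T\<close> is chosen so that both ends of the band have the same distance
    \<open>h\<close> from the height \<open>(1 - b) * b ^ k\<close> of the corner.\<close>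
  define h where "h = (1 - b)\<^sup>2 * b ^ k / (1 + b)"
  have "T * b ^ k - (1 - b) * b ^ k = h" "T * b ^ Suc k - (1 - b) * b ^ k = - h"
    using b_ne(2) by (simp_all add: T_def h_def field_simps power2_eq_square)
  then have yh: "\<bar>y - (1 - b) * b ^ k\<bar> \<le> h" using k by linarith
  have h0: "0 \<le> h" using p b_pos by (simp add: h_def)
  have h1: "h \<le> 1"
  proof -
    have "(1 - b)\<^sup>2 \<le> 1" using b_pos b_less by (simp add: power_le_one)
    moreover have "b ^ k \<le> 1" using b_pos b_less by (simp add: power_le_one)
    ultimately have "(1 - b)\<^sup>2 * b ^ k \<le> 1 * 1" using p by (intro mult_mono) auto
    then show ?thesis using b_pos by (simp add: h_def)
  qed
  have D: "Delta k \<ge> 3" by (rule Delta_ge)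
  have "(Delta k + 1) * h \<le> R - 2"
  proof -
    have "Delta k * b ^ Suc k \<le> 1" "b ^ Suc k \<le> b"
      using Delta_le[of k] b_pos b_less power_decreasing[of 1 "Suc k" b] by auto
    then have "(Delta k + 1) * b ^ Suc k \<le> 1 + b" by (simp add: algebra_simps)
    then have "(1 - b)\<^sup>2 / b * ((Delta k + 1) * b ^ Suc k / (1 + b)) \<le> (1 - b)\<^sup>2 / b * 1"
      using b_pos by (intro mult_left_mono) auto
    moreover have "(1 - b)\<^sup>2 / b * ((Delta k + 1) * b ^ Suc k / (1 + b)) = (Delta k + 1) * h"
      using b_ne(1) by (simp add: h_def)
    ultimately show ?thesis by (simp add: R_minus_2)
  qed
  moreover have "\<bar>u + Delta k\<bar> \<le> Delta k + 1 + e" using u D e by linarith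
  then have "\<bar>u + Delta k\<bar> * \<bar>y - (1 - b) * b ^ k\<bar> \<le> (Delta k + 1 + e) * h"
    using yh h0 by (intro mult_mono) auto
  moreover have "e * h \<le> e" using e h1 by (simp add: mult_left_le)
  ultimately have 1: "\<bar>u + Delta k\<bar> * \<bar>y - (1 - b) * b ^ k\<bar> \<le> R - 2 + 4 * e"
    using e by (simp add: algebra_simps)
  have "Delta k \<le> 1 / b ^ Suc k" using Delta_le[of k] b_pos by (simp add: le_divide_eq)
  also have "\<dots> \<le> 1 / b ^ Suc K" using k(1) b_pos b_less by (intro divide_left_mono power_decreasing) auto
  finally have 2: "\<bar>(u + Delta k) / 2\<bar> \<le> 2 + 1 / b ^ Suc K" using \<open>\<bar>u + Delta k\<bar> \<le> _\<close> e D by (simp add: abs_divide)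
  have 3: "\<bar>(y - (1 - b) * b ^ k) / 2\<bar> \<le> 2" using yh h1 by simp
  have "\<bar>(u + Delta k) / 2 * ((y - (1 - b) * b ^ k) / 2)\<bar> \<le> (R - 2) / 4 + e"
  proof -
    have "\<bar>(u + Delta k) / 2 * ((y - (1 - b) * b ^ k) / 2)\<bar> = \<bar>u + Delta k\<bar> * \<bar>y - (1 - b) * b ^ k\<bar> / 4"
      by (simp add: abs_mult)
    moreover have "z / 4 \<le> (r - 2) / 4 + e" if "z \<le> r - 2 + 4 * e" for z r :: real using that by (simp add: field_simps)
    ultimately show ?thesis using 1 by simp
  qed
  then show ?thesis using 2 3 k(1) by blast
qed

text \<open>The shift with \<open>X = Y = 0\<close> is the extremal one.\<close>

definition H :: "real \<Rightarrow> real \<Rightarrow> real \<Rightarrow> real \<Rightarrow> bool" where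
  "H c M X Y \<longleftrightarrow> good c M ((X - 1 + 1 / b) / 2) ((Y - 1 + b) / 2)"

text \<open>Negating and swapping the coordinates fixes the extremal shift up to R / 2 - 1 times (1,
  1), a lattice vector as R is even.\<close>

lemma H_swap:
  assumes "H c M (- Y) (- X)"
  shows "H c M X Y"
proof -
  obtain m where m: "R = 2 * m" using even_R by blast
  have e: "b + 1 / b = 2 * real_of_int m" using R_eq m by simp
  have "(- Y - 1 + 1 / b) / 2 = - ((Y - 1 + b) / 2) + of_int (m - 1) + of_int 0 * lam"
       "(- X - 1 + b) / 2 = - ((X - 1 + 1 / b) / 2) + of_int (m - 1) + of_int 0 * b"
    using e by (simp_all add: field_simps)
  then show ?thesis using assms unfolding H_def
    by (metis good_shift good_neg good_swap)
qed

text \<open>The second alternative is treated after the point reflection (X, Y) -> (2 - X, -Y),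
  which is negation followed by the lattice vector (\<open>lam - 1\<close>,
  \<open>b - 1\<close>).\<close>

lemma H_far:
  fixes X Y e :: real
  assumes K: "T * b ^ K \<le> e" and e: "0 < e" "e \<le> 1"
    and c: "c \<ge> (R - 2) / 4 + e" and M: "M \<ge> 2 + 1 / b ^ Suc K"
    and XY: "e \<le> Y \<and> Y \<le> T \<and> -1 \<le> X \<and> X \<le> 1 + e \<or> e \<le> - Y \<and> - Y \<le> T \<and> - e \<le> X \<and> X \<le> 2"
  shows "H c M X Y"
  using XY
proof (elim disjE)
  have M2: "M \<ge> 2"
  proof -
    have "0 \<le> 1 / b ^ Suc K" using b_pos by (simp del: power_Suc)
    then show ?thesis using M by linarith
  qed
  { assume A: "e \<le> Y \<and> Y \<le> T \<and> -1 \<le> X \<and> X \<le> 1 + e"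
    have "\<exists>k\<le>K. \<bar>(X - 1 + Delta k) / 2 * ((Y - (1 - b) * b ^ k) / 2)\<bar> \<le> (R - 2) / 4 + e
      \<and> \<bar>(X - 1 + Delta k) / 2\<bar> \<le> 2 + 1 / b ^ Suc K \<and> \<bar>(Y - (1 - b) * b ^ k) / 2\<bar> \<le> 2"
      by (rule far_corner) (use A K e in linarith)+
    then obtain k where k: "\<bar>(X - 1 + Delta k) / 2 * ((Y - (1 - b) * b ^ k) / 2)\<bar> \<le> (R - 2) / 4 + e"
      "\<bar>(X - 1 + Delta k) / 2\<bar> \<le> 2 + 1 / b ^ Suc K" "\<bar>(Y - (1 - b) * b ^ k) / 2\<bar> \<le> 2"
      by blast
    have "(X - 1 + 1 / b) / 2 + (Delta k - 1 / b) / 2 = (X - 1 + Delta k) / 2"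
      "(Y - 1 + b) / 2 + - (1 - b) * (b ^ k - 1) / 2 = (Y - (1 - b) * b ^ k) / 2"
      by (simp_all add: field_simps)
    note eq = this
    have "good c M ((X - 1 + Delta k) / 2) ((Y - (1 - b) * b ^ k) / 2)"
      by (rule goodI0) (use k c M M2 in linarith)+
    note good = this
    show "H c M X Y" unfolding H_def
      by (rule good_lat[OF lat_Delta[of k]]) (simp only: eq good) }
  { assume A: "e \<le> - Y \<and> - Y \<le> T \<and> - e \<le> X \<and> X \<le> 2"
    have "\<exists>k\<le>K. \<bar>(1 - X + Delta k) / 2 * ((- Y - (1 - b) * b ^ k) / 2)\<bar> \<le> (R - 2) / 4 + e
      \<and> \<bar>(1 - X + Delta k) / 2\<bar> \<le> 2 + 1 / b ^ Suc K \<and> \<bar>(- Y - (1 - b) * b ^ k) / 2\<bar> \<le> 2"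
      by (rule far_corner) (use A K e in linarith)+
    then obtain k where k: "\<bar>(1 - X + Delta k) / 2 * ((- Y - (1 - b) * b ^ k) / 2)\<bar> \<le> (R - 2) / 4 + e"
      "\<bar>(1 - X + Delta k) / 2\<bar> \<le> 2 + 1 / b ^ Suc K" "\<bar>(- Y - (1 - b) * b ^ k) / 2\<bar> \<le> 2"
      by blast
    have "lat (of_int (-1) * ((Delta k - 1 / b) / 2) + of_int (-1) * (lam - 1)) 
       (of_int (-1) * (- (1 - b) * (b ^ k - 1) / 2) + of_int (-1) * (b - 1))"
      by (intro lat_comb lat_Delta, unfold lat_def, rule exI[of _ "-1"], rule exI[of _ 1]) simp
    moreover have "of_int (-1) * ((Delta k - 1 / b) / 2) + of_int (-1) * (lam - 1) = - ((Delta k + 1 / b) / 2)"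
       "of_int (-1) * (- (1 - b) * (b ^ k - 1) / 2) + of_int (-1) * (b - 1) = (1 - b) * (b ^ k + 1) / 2"
      by (simp_all add: lam_def field_simps)
    ultimately have L: "lat (- ((Delta k + 1 / b) / 2)) ((1 - b) * (b ^ k + 1) / 2)" by (simp only:)
    have "(X - 1 + 1 / b) / 2 + - ((Delta k + 1 / b) / 2) = - ((1 - X + Delta k) / 2)"
      "(Y - 1 + b) / 2 + (1 - b) * (b ^ k + 1) / 2 = - ((- Y - (1 - b) * b ^ k) / 2)"
      by (simp_all add: field_simps)
    note eq = this
    have "good c M (- ((1 - X + Delta k) / 2)) (- ((- Y - (1 - b) * b ^ k) / 2))"
      by (rule goodI0, unfold minus_mult_minus abs_minus_cancel) (use k c M M2 in linarith)+
    note good = this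
    show "H c M X Y" unfolding H_def
      by (rule good_lat[OF L]) (simp only: eq good) }
qed

text \<open>The region is what the symmetries leave of the shifts outside the good rows. Unless X
  and Y are both smaller than \<open>e\<close> in modulus, \<open>H_far\<close> applies, directly or
  after \<open>H_swap\<close>.\<close>

lemma H_cover:
  fixes X Y e :: real
  assumes K: "T * b ^ K \<le> e" and e: "0 < e" "e \<le> 1 / 10"
    and c: "c \<ge> (R - 2) / 4 + R * e" and M: "M \<ge> 2 + 1 / b ^ Suc K"
    and XY: "0 \<le> X - Y" "X - Y \<le> 2" "-1 \<le> X + Y" "X + Y \<le> 1"
  shows "H c M X Y"
proof -
  have "4 * e \<le> R * e" using R4' e by simp
  then have c': "c \<ge> (R - 2) / 4 + e" using c e by linarith
  note far = H_far[OF K _ _ c' M]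
  have far': "H c M X Y" if "e \<le> - X \<and> - X \<le> T \<and> -1 \<le> - Y \<and> - Y \<le> 1 + e \<or> e \<le> X \<and> X \<le> T \<and> - e \<le> - Y \<and> - Y \<le> 2"
    by (rule H_swap, rule far) (use e that in auto)
  \<comment> \<open>If -Y exceeds \<open>T\<close>, the inequalities of the region leave 1/10 < X <
    9/10, so X can take over. If Y is small, then \<open>X < 1 + e \<le> T\<close>.\<close>
  consider "Y \<ge> e" | "Y < e" "X \<le> - e" | "Y \<le> - e" "X > - e" "- Y \<le> T" | "X > - e" "- Y > T"
    | "\<bar>Y\<bar> < e" "X \<ge> e" | "\<bar>Y\<bar> < e" "\<bar>X\<bar> < e" by linarith
  then show ?thesis
  proof cases
    case 1 then show ?thesis using XY T_ge e by (intro far) auto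
  next
    case 2 then show ?thesis using XY T_ge e by (intro far') auto
  next
    case 3 then show ?thesis using XY T_ge e by (intro far) auto
  next
    case 4 then show ?thesis using XY T_ge e by (intro far') auto
  next
    case 5 then show ?thesis using XY T_ge e by (intro far') auto
  next
    case 6
    \<comment> \<open>This shift is nearly extremal, and the initial corner itself suffices: its
      product is at most (R - 2) / 4 plus a multiple of \<open>e\<close>.\<close>
    have ib: "1 / b = R - b" by (rule inv_b)
    have 1: "\<bar>X - 1 + 1 / b\<bar> \<le> 1 / b - 1 + e" "\<bar>Y - 1 + b\<bar> \<le> 1 - b + e"
      using 6 b_less e ib R4' b_le by auto
    then have "\<bar>X - 1 + 1 / b\<bar> * \<bar>Y - 1 + b\<bar> \<le> (1 / b - 1 + e) * (1 - b + e)"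
      by (intro mult_mono) auto
    also have "\<dots> = (1 - b)\<^sup>2 / b + e * (1 / b - b + e)"
      using b_ne(1) by (simp add: field_simps power2_eq_square)
    also have "\<dots> \<le> R - 2 + e * (R + 1)"
      unfolding R_minus_2 ib using e b_pos by (intro add_left_mono mult_left_mono) auto
    finally have fin: "\<bar>X - 1 + 1 / b\<bar> * \<bar>Y - 1 + b\<bar> \<le> R - 2 + e * (R + 1)" .
    have "\<bar>(X - 1 + 1 / b) / 2 * ((Y - 1 + b) / 2)\<bar> \<le> c"
    proof -
      have *: "e * real_of_int (R + 1) = R * e + e" by (simp add: algebra_simps)
      define P where "P = \<bar>X - 1 + 1 / b\<bar> * \<bar>Y - 1 + b\<bar>"
      have "P \<le> 4 * c"
        using fin c \<open>4 * e \<le> R * e\<close> e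
        unfolding * of_int_diff of_int_numeral P_def[symmetric] diff_divide_distrib by linarith
      then have "\<bar>X - 1 + 1 / b\<bar> * \<bar>Y - 1 + b\<bar> \<le> 4 * c" unfolding P_def .
      then show ?thesis by (simp add: abs_mult)
    qed
    moreover have "1 / b \<le> 1 / b ^ Suc K"
      using b_pos b_less power_decreasing[of 1 "Suc K" b] by (intro divide_left_mono) (auto simp del: power_Suc)
    ultimately show ?thesis unfolding H_def using 1 M e b_pos
      by (intro goodI0) auto
  qed
qed

text \<open>Multiples of (\<open>lam\<close>, \<open>b\<close>) bring d = x - y into [0, W), where
  \<open>(W - 1)\<^sup>2 = R\<^sup>2 - 4\<close>. Then \<open>good_row\<close> settles d up to (W -
  1) / 2 and, after one more translation, d from (W + 1) / 2 on. Only the strip between them is left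
  for \<open>H_cover\<close>.\<close>

lemma covering:
  fixes e :: real
  assumes e: "0 < e"
  shows "\<exists>M. \<forall>x y. good ((R - 2) / 4 + e) M x y"
proof -
  define e' where "e' = min (1/10) (e / R)"
  have e': "0 < e'" "e' \<le> 1/10" "R * e' \<le> e" using e R4' by (auto simp: e'_def min_def field_simps)
  have "(\<lambda>K. T * b ^ K) \<longlonglongrightarrow> T * 0" using b_pos b_less
    by (intro tendsto_intros LIMSEQ_realpow_zero) auto
  then have "\<forall>\<^sub>F K in sequentially. T * b ^ K < e'" using e' by (intro order_tendstoD) auto
  then obtain K where K: "T * b ^ K \<le> e'" by (meson eventually_sequentially less_imp_le order_refl)
  define M where "M = R + 2 + 1 / b ^ Suc K"
  define c where "c = (R - 2) / 4 + e"
  have M: "M \<ge> R" "M \<ge> 2 + 1 / b ^ Suc K" using R4' b_pos by (auto simp: M_def)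
  have c: "c \<ge> (R - 2) / 4" "c \<ge> (R - 2) / 4 + R * e'" using e e' by (auto simp: c_def)
  obtain m where m: "R = 2 * m" using even_R by blast
  define W where "W = lam - b"
  have W: "W = R + 1 - 2 * b" "W > 0" using lam_eq R4' b_less by (auto simp: W_def)
  have h2: "(W - 1)\<^sup>2 = R\<^sup>2 - 4" using b_eq by (simp add: W power2_eq_square algebra_simps)
  have "good c M x y" for x y
  proof -
    define j where "j = - \<lfloor>(x - y) / W\<rfloor>"
    define x1 y1 where "x1 = x + of_int j * lam" and "y1 = y + of_int j * b"
    have d: "x1 - y1 = x - y + j * W" by (simp add: x1_def y1_def W_def algebra_simps)
    have "of_int \<lfloor>(x - y) / W\<rfloor> \<le> (x - y) / W" "(x - y) / W < of_int \<lfloor>(x - y) / W\<rfloor> + 1"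
      by (rule of_int_floor_le, rule real_of_int_floor_add_one_gt)
    then have "- j * W \<le> x - y" "x - y < (1 - j) * W" using W(2)
      unfolding j_def by (simp_all only: le_divide_eq divide_less_eq) (auto simp: add.commute)
    then have d0: "0 \<le> x1 - y1" "x1 - y1 < W" unfolding d by (auto simp: algebra_simps)
    have "good c M x1 y1"
    proof -
      consider "2 * (x1 - y1) \<le> W - 1" | "2 * (x1 - y1) \<ge> W + 1" | "2 * (x1 - y1) > W - 1" "2 * (x1 - y1) < W + 1" by linarith
      then show ?thesis
      proof cases
        case 1
        have "(2 * (x1 - y1))\<^sup>2 \<le> (W - 1)\<^sup>2" by (rule power_mono) (use 1 d0 in auto)
        moreover have "(2 * (x1 - y1))\<^sup>2 = 4 * (x1 - y1)\<^sup>2" by (simp only: power_mult_distrib) simp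
        ultimately show ?thesis using c M h2 by (intro good_row) auto
      next
        case 2
        have "(2 * (W - (x1 - y1)))\<^sup>2 \<le> (W - 1)\<^sup>2" by (rule power_mono) (use 2 d0 in auto)
        moreover have "(x1 + of_int 0 + of_int (-1) * lam - (y1 + of_int 0 + of_int (-1) * b))\<^sup>2 = (W - (x1 - y1))\<^sup>2"
          by (simp add: W_def power2_eq_square algebra_simps)
        moreover have "(2 * (W - (x1 - y1)))\<^sup>2 = 4 * (W - (x1 - y1))\<^sup>2" by (simp only: power_mult_distrib) simp
        ultimately show ?thesis using c M h2
          by (intro good_shift[of c M x1 0 "-1" y1] good_row) simp_all
      next
        case 3
        \<comment> \<open>As \<open>W - 1 = 1 / b - b\<close>, the strip becomes
          \<open>0 \<le> X - Y \<le> 2\<close>. Adding (1, 1) moves X + Y by 4, which gives the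
          range [-1, 3), and the reflection (X, Y) -> (2 - X, -Y) folds it to [-1, 1].\<close>
        define X Y where "X = 2 * x1 + 1 - 1 / b" and "Y = 2 * y1 + 1 - b"
        have XmY: "0 \<le> X - Y" "X - Y \<le> 2" using 3 unfolding X_def Y_def inv_b W by auto
        define n where "n = \<lfloor>(X + Y + 1) / 4\<rfloor>"
        have "of_int n \<le> (X + Y + 1) / 4" "(X + Y + 1) / 4 < of_int n + 1"
          unfolding n_def by (rule of_int_floor_le, rule real_of_int_floor_add_one_gt)
        then have n: "4 * real_of_int n \<le> X + Y + 1" "X + Y + 1 < 4 * real_of_int n + 4" by simp_all
        define X' Y' where "X' = X - 2 * n" and "Y' = Y - 2 * n"
        have XY': "X' - Y' = X - Y" "-1 \<le> X' + Y'" "X' + Y' < 3" using n by (auto simp: X'_def Y'_def)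
        have x: "x1 + of_int (- n) + of_int 0 * lam = (X' - 1 + 1 / b) / 2"
          "y1 + of_int (- n) + of_int 0 * b = (Y' - 1 + b) / 2"
          by (auto simp: X_def Y_def X'_def Y'_def field_simps)
        note H = H_cover[OF K e'(1,2) c(2) M(2), unfolded H_def]
        have "good c M ((X' - 1 + 1 / b) / 2) ((Y' - 1 + b) / 2)"
        proof (cases "X' + Y' \<le> 1")
          case True
          show ?thesis by (rule H) (use XmY XY' True in auto)
        next
          case False
          have "good c M ((2 - X' - 1 + 1 / b) / 2) ((- Y' - 1 + b) / 2)"
            by (rule H) (use XmY XY' False in auto)
          moreover have "(2 - X' - 1 + 1 / b) / 2 = - ((X' - 1 + 1 / b) / 2) + of_int (- 1) + of_int 1 * lam"
            "(- Y' - 1 + b) / 2 = - ((Y' - 1 + b) / 2) + of_int (- 1) + of_int 1 * b"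
            by (simp_all add: lam_def field_simps)
          ultimately show ?thesis by (metis good_neg good_shift)
        qed
        then show ?thesis using good_shift[of c M x1 "- n" 0 y1] unfolding x by blast
      qed
    qed
    then show ?thesis using good_shift[of c M x 0 j y] unfolding x1_def y1_def by simp
  qed
  then show ?thesis unfolding c_def by blast
qed

text \<open>Once x - y is reduced modulo r - t, the point supplied by \<open>covering\<close> has a
  coefficient j bounded by the constant \<open>J\<close>. Replacing (\<open>lam\<close>,
  \<open>b\<close>) by (r, t) therefore moves it by at most \<open>J * \<eta>\<close> in each
  coordinate.\<close>

lemma covering_near:
  fixes e :: real
  assumes e: "0 < e"
  shows "\<exists>\<eta>>0. \<exists>M. \<forall>(r::real) (t::real) (x::real) (y::real). \<bar>r - lam\<bar> \<le> \<eta> \<longrightarrow> \<bar>t - b\<bar> \<le> \<eta> \<longrightarrow>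
    (\<exists>(i::int) (j::int). \<bar>(x + i + j * r) * (y + i + j * t)\<bar> \<le> (R - 2) / 4 + e \<and> \<bar>y + i + j * t\<bar> \<le> M)"
proof -
  obtain M where M: "good ((R - 2) / 4 + e / 2) M x y" for x y
    using covering[of "e / 2"] e by auto
  have M0: "0 \<le> M" using M[of 0 0] unfolding good_def by force
  define W where "W = lam - b"
  have W: "W \<ge> 4" using lam_eq R4' b_le by (simp add: W_def)
  define J where "J = 2 * M + 2"
  define \<eta> where "\<eta> = min 1 (min (1 / J) (e / 2 / (J * (2 * M + 1))))"
  have J: "J > 0" using M0 by (simp add: J_def)
  have \<eta>: "0 < \<eta>" "\<eta> \<le> 1" "J * \<eta> \<le> 1" "J * \<eta> * (2 * M + 1) \<le> e / 2"
  proof -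
    show "0 < \<eta>" "\<eta> \<le> 1" using J e M0 by (auto simp: \<eta>_def)
    have "\<eta> \<le> 1 / J" by (simp add: \<eta>_def)
    then show "J * \<eta> \<le> 1" using J by (simp add: field_simps)
    have "\<eta> \<le> e / 2 / (J * (2 * M + 1))" by (simp add: \<eta>_def)
    moreover have "0 < J * (2 * M + 1)" using J M0 by simp
    ultimately have "\<eta> * (J * (2 * M + 1)) \<le> e / 2" by (simp only: le_divide_eq) simp
    then show "J * \<eta> * (2 * M + 1) \<le> e / 2" by (simp only: mult_ac)
  qed
  have "\<exists>(i::int) (j::int). \<bar>(x + i + j * r) * (y + i + j * t)\<bar> \<le> (R - 2) / 4 + e \<and> \<bar>y + i + j * t\<bar> \<le> M + 1"
    if r: "\<bar>r - lam\<bar> \<le> \<eta>" and t: "\<bar>t - b\<bar> \<le> \<eta>" for r t x y :: real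
  proof -
    define W' where "W' = r - t"
    have W': "0 < W'" "W' \<le> 2 * W" using r t \<eta> W by (auto simp: W'_def W_def)
    define k where "k = - \<lfloor>(x - y) / W'\<rfloor>"
    define x1 y1 where "x1 = x + of_int k * r" and "y1 = y + of_int k * t"
    have d: "x1 - y1 = x - y + k * W'" by (simp add: x1_def y1_def W'_def algebra_simps)
    have "of_int \<lfloor>(x - y) / W'\<rfloor> \<le> (x - y) / W'" "(x - y) / W' < of_int \<lfloor>(x - y) / W'\<rfloor> + 1"
      by (rule of_int_floor_le, rule real_of_int_floor_add_one_gt)
    then have "- k * W' \<le> x - y" "x - y < (1 - k) * W'" using W'(1)
      unfolding k_def by (simp_all only: le_divide_eq divide_less_eq) (auto simp: add.commute)
    then have d0: "0 \<le> x1 - y1" "x1 - y1 < W'" unfolding d by (auto simp: algebra_simps)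
    obtain i j :: int where ij: "\<bar>(x1 + i + j * lam) * (y1 + i + j * b)\<bar> \<le> (R - 2) / 4 + e / 2"
      "\<bar>x1 + i + j * lam\<bar> \<le> M" "\<bar>y1 + i + j * b\<bar> \<le> M"
      using M[of x1 y1] unfolding good_def by blast
    have "x1 + i + j * lam - (y1 + i + j * b) = x1 - y1 + j * W" by (simp add: W_def algebra_simps)
    then have "\<bar>j * W\<bar> \<le> 2 * M + W'" using ij d0 by linarith
    also have "\<dots> \<le> J * W"
    proof -
      have "2 * M * 1 \<le> 2 * M * W" using M0 W by (intro mult_left_mono) auto
      then show ?thesis using W'(2) by (simp add: J_def algebra_simps)
    qed
    finally have j: "\<bar>real_of_int j\<bar> \<le> J" using W by (simp add: abs_mult)
    define u v where "u = j * (r - lam)" and "v = j * (t - b)"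
    have uv: "\<bar>u\<bar> \<le> J * \<eta>" "\<bar>v\<bar> \<le> J * \<eta>"
      unfolding u_def v_def abs_mult using j r t J by (intro mult_mono; simp)+
    define X Y where "X = x1 + i + j * lam" and "Y = y1 + i + j * b"
    have eq: "x + of_int i + of_int (k + j) * r = X + u" "y + of_int i + of_int (k + j) * t = Y + v"
      by (simp_all add: X_def Y_def u_def v_def x1_def y1_def algebra_simps)
    have "(X + u) * (Y + v) = X * Y + (u * Y + v * X + u * v)" by (simp add: algebra_simps)
    then have "\<bar>(X + u) * (Y + v)\<bar> \<le> \<bar>X * Y\<bar> + (\<bar>u\<bar> * \<bar>Y\<bar> + \<bar>v\<bar> * \<bar>X\<bar> + \<bar>u\<bar> * \<bar>v\<bar>)"
      unfolding abs_mult[symmetric] by linarith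
    moreover have "\<bar>u\<bar> * \<bar>Y\<bar> \<le> J * \<eta> * M" "\<bar>v\<bar> * \<bar>X\<bar> \<le> J * \<eta> * M" "\<bar>u\<bar> * \<bar>v\<bar> \<le> J * \<eta> * 1"
      using uv ij J \<eta> unfolding X_def Y_def by (intro mult_mono; simp)+
    ultimately have "\<bar>(X + u) * (Y + v)\<bar> \<le> \<bar>X * Y\<bar> + J * \<eta> * (2 * M + 1)"
      by (simp add: algebra_simps)
    also have "\<dots> \<le> (R - 2) / 4 + e" using ij(1) \<eta>(4) unfolding X_def Y_def by linarith
    finally have "\<bar>(X + u) * (Y + v)\<bar> \<le> (R - 2) / 4 + e" .
    moreover have "\<bar>Y + v\<bar> \<le> M + 1" using uv ij \<eta> unfolding Y_def by linarith
    ultimately show ?thesis by (intro exI[of _ i] exI[of _ "k + j"]) (simp only: eq)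
  qed
  then show ?thesis using \<eta>(1) by blast
qed

end

section \<open>Continued fractions and the upper bound\<close>

lemma nint_dist_le: "nint_dist x \<le> \<bar>x - of_int m\<bar>"
proof (cases "x \<ge> of_int m")
  case True
  then have "real_of_int m \<le> \<lfloor>x\<rfloor>" by (simp add: le_floor_iff)
  then show ?thesis unfolding nint_dist_def frac_def using of_int_floor_le[of x] by linarith
next
  case False
  then have "\<lfloor>x\<rfloor> + 1 \<le> m" by linarith
  then have "real_of_int \<lfloor>x\<rfloor> + 1 \<le> m" by linarith
  then show ?thesis unfolding nint_dist_def frac_def using of_int_floor_le[of x] by linarith
qed

lemma nint_dist_eq: "\<exists>m::int. nint_dist x = \<bar>x - of_int m\<bar>"
proof -
  have "nint_dist x = \<bar>x - of_int \<lfloor>x\<rfloor>\<bar> \<or> nint_dist x = \<bar>x - of_int (\<lfloor>x\<rfloor> + 1)\<bar>"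
    unfolding nint_dist_def frac_def using of_int_floor_le[of x] real_of_int_floor_add_one_gt[of x] by (auto simp: min_def)
  then show ?thesis by blast
qed

text \<open>If the liminf exceeded c, only finitely many n would have a product at most c, and their
  distances would have a positive minimum as gamma is not in Z + alpha Z. An admissible point closer
  than this minimum is a contradiction.\<close>

lemma M_inhom_le:
  fixes \<alpha> \<gamma> c :: real
  assumes \<gamma>: "\<not> (\<exists>m k::int. \<gamma> = real_of_int m + \<alpha> * real_of_int k)"
    and approx: "\<And>\<delta>. \<delta> > 0 \<Longrightarrow> \<exists>(n::int) (m::int). \<bar>n * \<alpha> - m - \<gamma>\<bar> < \<delta> \<and> \<bar>real_of_int n\<bar> * \<bar>n * \<alpha> - m - \<gamma>\<bar> \<le> c"
  shows "M_inhom \<alpha> \<gamma> \<le> ereal c"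
proof (rule ccontr)
  assume "\<not> ?thesis"
  then have "\<forall>\<^sub>F n in cofinite. ereal c < ereal (\<bar>real_of_int n\<bar> * nint_dist (real_of_int n * \<alpha> - \<gamma>))"
    unfolding M_inhom_def by (intro less_LiminfD) simp
  then have fin: "finite {n::int. \<not> c < \<bar>real_of_int n\<bar> * nint_dist (real_of_int n * \<alpha> - \<gamma>)}" (is "finite ?S")
    by (simp add: eventually_cofinite)
  define \<delta> where "\<delta> = Min (insert 1 ((\<lambda>n. nint_dist (real_of_int n * \<alpha> - \<gamma>)) ` ?S))"
  have pos: "nint_dist (real_of_int n * \<alpha> - \<gamma>) > 0" for n :: int
  proof -
    obtain m :: int where m: "nint_dist (real_of_int n * \<alpha> - \<gamma>) = \<bar>real_of_int n * \<alpha> - \<gamma> - of_int m\<bar>"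
      using nint_dist_eq by blast
    have "real_of_int n * \<alpha> - \<gamma> - of_int m \<noteq> 0"
    proof
      assume "real_of_int n * \<alpha> - \<gamma> - of_int m = 0"
      then have "\<gamma> = real_of_int (- m) + \<alpha> * real_of_int n" by (simp add: algebra_simps)
      then show False using \<gamma> by blast
    qed
    then show ?thesis unfolding m by simp
  qed
  have "\<delta> > 0" unfolding \<delta>_def using fin pos by (subst Min_gr_iff) auto
  then obtain n m :: int where nm: "\<bar>n * \<alpha> - m - \<gamma>\<bar> < \<delta>" "\<bar>real_of_int n\<bar> * \<bar>n * \<alpha> - m - \<gamma>\<bar> \<le> c"
    using approx by blast
  have le: "nint_dist (real_of_int n * \<alpha> - \<gamma>) \<le> \<bar>n * \<alpha> - m - \<gamma>\<bar>"
    using nint_dist_le[of "real_of_int n * \<alpha> - \<gamma>" m] by (simp add: algebra_simps)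
  have "\<bar>real_of_int n\<bar> * nint_dist (real_of_int n * \<alpha> - \<gamma>) \<le> \<bar>real_of_int n\<bar> * \<bar>n * \<alpha> - m - \<gamma>\<bar>"
    using le by (intro mult_left_mono) auto
  then have "n \<in> ?S" using nm(2) by simp
  then have "\<delta> \<le> nint_dist (real_of_int n * \<alpha> - \<gamma>)" unfolding \<delta>_def using fin by (intro Min_le) auto
  then show False using le nm(1) by simp
qed

fun lrec :: "(nat \<Rightarrow> int) \<Rightarrow> int \<Rightarrow> int \<Rightarrow> nat \<Rightarrow> int" where
  "lrec a u v 0 = u"
| "lrec a u v (Suc 0) = v"
| "lrec a u v (Suc (Suc n)) = a n * lrec a u v (Suc n) - lrec a u v n"

text \<open>\<open>A n\<close> is the remainder alpha_n, so alpha itself is \<open>A 0\<close>, and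
  \<open>a n\<close> is the digit with index n + 1 in the usual numbering.\<close>

locale ncf = quad_root R b for R :: int and b :: real +
  fixes l :: nat and A :: "nat \<Rightarrow> real" and a :: "nat \<Rightarrow> int"
  assumes l_pos: "l \<ge> 1" and A_pos: "0 < A n" and A_less: "A n < 1"
    and A_rec: "A (Suc n) = of_int (a n) - 1 / A n"
    and a_eq: "a n = (if n mod (l + 1) = 0 then R + 1 else R)"
begin

section \<open>Convergents of the negative continued fraction\<close>

definition q :: "nat \<Rightarrow> int" where "q = lrec a 0 1"
definition p :: "nat \<Rightarrow> int" where "p = lrec a (-1) 0"
definition D :: "nat \<Rightarrow> real" where "D n = q n * A 0 - p n"
text \<open>This is the finite expansion with the digits read backwards from
  \<open>a (n - 1)\<close> to \<open>a 0\<close>, the mirror image of the tail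
  \<open>A n\<close>.\<close>

definition B :: "nat \<Rightarrow> real" where "B n = q n / q (Suc n)"

lemma q_simps [simp]: "q 0 = 0" "q (Suc 0) = 1" "q (Suc (Suc n)) = a n * q (Suc n) - q n"
  and p_simps [simp]: "p 0 = -1" "p (Suc 0) = 0" "p (Suc (Suc n)) = a n * p (Suc n) - p n"
  by (simp_all add: q_def p_def)

lemma a_start: "a (c * (l + 1)) = R + 1"
  unfolding a_eq mod_mult_self2_is_0 by simp

lemma a_block: "0 < k \<Longrightarrow> k \<le> l \<Longrightarrow> a (c * (l + 1) + k) = R"
  unfolding a_eq mod_mult_self3 by simp

lemma a_ge: "a n \<ge> R"
  by (simp add: a_eq)

lemma a_ge': "real_of_int (a n) \<ge> R"
  using a_ge by simp

lemma D_simps: "D 0 = 1" "D (Suc 0) = A 0" "D (Suc (Suc n)) = a n * D (Suc n) - D n"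
  by (simp_all add: D_def algebra_simps)

lemma D_Suc: "D (Suc n) = A n * D n"
proof (induction n)
  case (Suc n)
  have "D n = D (Suc n) / A n" using Suc A_pos[of n] by simp
  then show ?case by (simp add: D_simps A_rec algebra_simps)
qed (simp add: D_simps)

lemma D_pos: "D n > 0"
  by (induction n) (simp_all add: D_simps D_Suc A_pos)

lemma q_Suc_ge: "q (Suc n) \<ge> q n + 1 \<and> q n \<ge> 0"
proof (induction n)
  case (Suc n)
  have "a n * q (Suc n) \<ge> 2 * q (Suc n)" using a_ge[of n] R4 Suc by (intro mult_right_mono) auto
  then show ?case using Suc unfolding q_simps by linarith
qed simp

lemma q_pos: "q (Suc n) > 0"
  using q_Suc_ge[of n] by simp

lemma det: "q (Suc n) * D n - q n * D (Suc n) = 1"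
  by (induction n) (simp_all add: D_simps algebra_simps)

lemma B_0: "B 0 = 0"
  by (simp add: B_def)

lemma B_Suc: "B (Suc n) = 1 / (a n - B n)"
  using q_pos[of n] q_pos[of "Suc n"] by (simp add: B_def field_simps)

lemma A_eq: "A n = 1 / (a n - A (Suc n))"
  using A_pos[of n] by (simp add: A_rec)

lemma qD: "q (Suc n) * D n * (1 - A n * B n) = 1"
  using det[of n] q_pos[of n] by (simp add: D_Suc B_def field_simps)

text \<open>The map t -> 1 / (R - t) fixes \<open>b\<close> and shrinks the distance to it by a
  factor 3, because R - t > 3. A larger digit only lowers the value.\<close>

lemma step_le:
  fixes t e r :: real
  assumes "t \<le> b + e" "0 \<le> e" "t < 1" "r \<ge> real_of_int R"
  shows "1 / (r - t) \<le> b + e / 3"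
proof -
  have 1: "1 / (r - t) \<le> 1 / (R - t)" using assms R4' by (intro divide_left_mono) auto
  have "1 / (R - t) = b + b * (t - b) / (R - t)"
    using assms R4' b_eq by (simp add: field_simps)
  also have "b * (t - b) / (R - t) \<le> e / 3"
  proof -
    have "b * (t - b) \<le> b * e" using assms b_pos by (intro mult_left_mono) auto
    also have "\<dots> \<le> 1 * e" using assms b_less by (intro mult_right_mono) auto
    also have "\<dots> \<le> e / 3 * (R - t)"
    proof -
      have "e / 3 * 3 \<le> e / 3 * (R - t)" using assms R4' by (intro mult_left_mono) auto
      then show ?thesis by simp
    qed
    finally show ?thesis using assms R4' by (simp add: divide_le_eq)
  qed
  finally show ?thesis using 1 by simp
qed

lemma step_ge:
  fixes t e :: real
  assumes "t \<ge> b - e" "0 \<le> e" "t < 1"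
  shows "1 / (R - t) \<ge> b - e / 3"
proof -
  have "1 / (R - t) = b - b * (b - t) / (R - t)"
    using assms R4' b_eq by (simp add: field_simps)
  moreover have "b * (b - t) / (R - t) \<le> e / 3"
  proof -
    have "b * (b - t) \<le> b * e" using assms b_pos by (intro mult_left_mono) auto
    also have "\<dots> \<le> 1 * e" using assms b_less by (intro mult_right_mono) auto
    also have "\<dots> \<le> e / 3 * (R - t)"
    proof -
      have "e / 3 * 3 \<le> e / 3 * (R - t)" using assms R4' by (intro mult_left_mono) auto
      then show ?thesis by simp
    qed
    finally show ?thesis using assms R4' by (simp add: divide_le_eq)
  qed
  ultimately show ?thesis by simp
qed

text \<open>\<open>A n\<close> depends on later digits, so an induction on n has no base. Instead
  the crude bound 1 is used m digits further on, and m tends to infinity.\<close>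

lemma A_le: "A n \<le> b"
proof -
  have *: "A n \<le> b + (1/3) ^ m" for n m
  proof (induction m arbitrary: n)
    case 0 then show ?case using A_less[of n] b_pos by simp
  next
    case (Suc m)
    then show ?case using step_le[of "A (Suc n)" "(1/3) ^ m" "a n"] A_less a_ge' by (simp flip: A_eq)
  qed
  have "(\<lambda>m. b + (1/3) ^ m) \<longlonglongrightarrow> b + 0" by (intro tendsto_intros LIMSEQ_realpow_zero) auto
  then show ?thesis using * by (intro LIMSEQ_le_const[of _ b]) auto
qed

lemma B_bounds: "0 \<le> B n" "B n \<le> b"
proof -
  show "0 \<le> B n" using q_Suc_ge[of n] by (simp add: B_def)
  show "B n \<le> b"
  proof (induction n)
    case (Suc n)
    then show ?case using step_le[of "B n" 0 "a n"] a_ge' b_less by (simp add: B_Suc)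
  qed (use b_pos in \<open>simp add: B_0\<close>)
qed

lemma A_near: "(\<And>i. n \<le> i \<Longrightarrow> i < n + m \<Longrightarrow> a i = R) \<Longrightarrow> \<bar>A n - b\<bar> \<le> (1/3) ^ m"
proof (induction m arbitrary: n)
  case 0 then show ?case using A_less[of n] A_pos[of n] b_pos b_less by simp
next
  case (Suc m)
  have "\<bar>A (Suc n) - b\<bar> \<le> (1/3) ^ m" by (rule Suc.IH) (use Suc.prems in auto)
  moreover have "a n = R" using Suc.prems by simp
  moreover have "b - (1/3) ^ m / 3 \<le> 1 / (R - A (Suc n))"
    by (rule step_ge) (use \<open>\<bar>A (Suc n) - b\<bar> \<le> _\<close> A_less[of "Suc n"] in auto)
  ultimately have "b - (1/3) ^ m / 3 \<le> A n" by (simp add: A_eq[of n])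
  then show ?case using A_le[of n] by simp
qed

lemma B_near: "(\<And>i. n - m \<le> i \<Longrightarrow> i < n \<Longrightarrow> a i = R) \<Longrightarrow> m \<le> n \<Longrightarrow> \<bar>B n - b\<bar> \<le> (1/3) ^ m"
proof (induction m arbitrary: n)
  case 0 then show ?case using B_bounds[of n] b_pos b_less by simp
next
  case (Suc m)
  then obtain k where k: "n = Suc k" by (cases n) auto
  have "\<bar>B k - b\<bar> \<le> (1/3) ^ m" by (rule Suc.IH) (use Suc.prems k in auto)
  moreover have "a k = R" using Suc.prems k by simp
  moreover have "b - (1/3) ^ m / 3 \<le> 1 / (R - B k)"
    by (rule step_ge) (use \<open>\<bar>B k - b\<bar> \<le> _\<close> B_bounds[of k] b_less in auto)
  ultimately have "b - (1/3) ^ m / 3 \<le> B n" by (simp add: B_Suc k)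
  then show ?case using B_bounds[of n] by simp
qed

lemma D_le: "D (k + n) \<le> b ^ n * D k"
proof (induction n)
  case (Suc n)
  have "A (k + n) * D (k + n) \<le> b * (b ^ n * D k)"
    using Suc A_le A_pos D_pos[of "k + n"] b_pos by (intro mult_mono) (auto intro: less_imp_le)
  then show ?case by (simp add: D_Suc)
qed simp

text \<open>In the scale where the basis vector with index \<open>Suc N\<close> is (1, 1), the next
  one is (\<open>R + 1 - B N\<close>, \<open>A (Suc N)\<close>). It is close to (\<open>lam\<close>,
  \<open>b\<close>) when the digit R + 1 at \<open>N\<close> has \<open>l\<close> digits R on both
  sides. By the determinant identity the scaling contributes the factor 1 / (R + 1 - B N - A (Suc
  N)).\<close>

lemma M_inhom_upper:
  fixes \<eta> e M \<gamma> :: real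
  assumes \<eta>: "(1/3) ^ l \<le> \<eta>" "\<eta> \<le> 1" and e: "0 < e"
    and cov: "\<And>(r::real) (t::real) (x::real) (y::real). \<bar>r - lam\<bar> \<le> \<eta> \<Longrightarrow> \<bar>t - b\<bar> \<le> \<eta> \<Longrightarrow>
    (\<exists>(i::int) (j::int). \<bar>(x + i + j * r) * (y + i + j * t)\<bar> \<le> (R - 2) / 4 + e \<and> \<bar>y + i + j * t\<bar> \<le> M)"
    and \<gamma>: "\<not> (\<exists>m k::int. \<gamma> = real_of_int m + A 0 * real_of_int k)"
  shows "M_inhom (A 0) \<gamma> \<le> ereal (((R - 2) / 4 + e) / (lam - b - 2 * \<eta>))"
proof (rule M_inhom_le[OF \<gamma>])
  fix \<delta> :: real assume \<delta>: "\<delta> > 0"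
  have M0: "0 \<le> M" 
  proof -
    have "0 \<le> \<eta>" using \<eta>(1) zero_le_power[of "1/3::real" l] by linarith
    then obtain i j :: int where "\<bar>0 + i + j * b\<bar> \<le> M" using cov[of lam b 0 0] by auto
    then show ?thesis using abs_ge_zero[of "0 + i + j * b"] by linarith
  qed
  have "(\<lambda>n. M * b ^ n) \<longlonglongrightarrow> M * 0" using b_pos b_less by (intro tendsto_intros LIMSEQ_realpow_zero) auto
  then have "\<forall>\<^sub>F n in sequentially. M * b ^ n < \<delta>" using \<delta> by (intro order_tendstoD) auto
  then obtain n0 where n0: "\<And>n. n \<ge> n0 \<Longrightarrow> M * b ^ n < \<delta>" by (auto simp: eventually_sequentially)
  \<comment> \<open>\<open>Suc n0\<close> instead of \<open>n0\<close> guarantees a full block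
    before \<open>N\<close>; position 0 has no digits before it.\<close>
  define N where "N = Suc n0 * (l + 1)"
  have N: "n0 \<le> N" "l \<le> N" by (auto simp: N_def)
  have aN: "a N = R + 1" unfolding N_def by (rule a_start)
  have r: "\<bar>R + 1 - B N - lam\<bar> \<le> \<eta>"
  proof -
    have "\<bar>B N - b\<bar> \<le> (1/3) ^ l"
    proof (rule B_near)
      fix i assume i: "N - l \<le> i" "i < N"
      have "n0 * (l + 1) \<le> i" using i(1) by (simp add: N_def)
      then obtain k where k: "i = n0 * (l + 1) + k" by (meson le_Suc_ex)
      then show "a i = R" unfolding k by (intro a_block) (use i k in \<open>auto simp: N_def\<close>)
    qed fact
    then show ?thesis using \<eta> lam_eq by simp
  qed
  have t: "\<bar>A (Suc N) - b\<bar> \<le> \<eta>"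
  proof -
    have "\<bar>A (Suc N) - b\<bar> \<le> (1/3) ^ l"
    proof (rule A_near)
      fix i assume i: "Suc N \<le> i" "i < Suc N + l"
      then obtain k where k: "i = Suc n0 * (l + 1) + k" unfolding N_def by (meson Suc_leD le_Suc_ex)
      then show "a i = R" unfolding k by (intro a_block) (use i k in \<open>auto simp: N_def\<close>)
    qed
    then show ?thesis using \<eta> by simp
  qed
  obtain i j :: int where
    ij: "\<bar>(0 + i + j * (R + 1 - B N)) * (- \<gamma> / D (Suc N) + i + j * A (Suc N))\<bar> \<le> (R - 2) / 4 + e"
      "\<bar>- \<gamma> / D (Suc N) + i + j * A (Suc N)\<bar> \<le> M"
    using cov[OF r t, of 0 "- \<gamma> / D (Suc N)"] by auto
  define n m where "n = i * q (Suc N) + j * q (Suc (Suc N))" and "m = i * p (Suc N) + j * p (Suc (Suc N))"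
  have Q: "real_of_int (q (Suc N)) > 0" "D (Suc N) > 0" using q_pos D_pos by auto
  have q2: "real_of_int (q (Suc (Suc N))) = q (Suc N) * (R + 1 - B N)"
    using Q by (simp add: B_def aN algebra_simps)
  have n: "real_of_int n = q (Suc N) * (0 + i + j * (R + 1 - B N))"
    unfolding n_def of_int_add of_int_mult q2 by (simp add: algebra_simps)
  have y: "n * A 0 - m - \<gamma> = D (Suc N) * (- \<gamma> / D (Suc N) + i + j * A (Suc N))"
  proof -
    have "n * A 0 - m = i * D (Suc N) + j * D (Suc (Suc N))"
      by (simp add: n_def m_def D_def algebra_simps)
    then show ?thesis using Q by (simp add: D_Suc[of "Suc N"] algebra_simps)
  qed
  have "\<bar>n * A 0 - m - \<gamma>\<bar> \<le> D (Suc N) * M"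
    unfolding y abs_mult using Q ij(2) by (intro mult_mono) auto
  also have "\<dots> \<le> b ^ Suc N * M" using D_le[of 0 "Suc N"] M0 unfolding D_simps(1) mult_1_right add_0
    by (rule mult_right_mono)
  also have "\<dots> < \<delta>" using n0[of "Suc N"] N by (simp add: mult.commute)
  finally have 1: "\<bar>n * A 0 - m - \<gamma>\<bar> < \<delta>" .
  have W: "R + 1 - B N - A (Suc N) \<ge> lam - b - 2 * \<eta>" "lam - b - 2 * \<eta> > 0" using r t \<eta> lam_eq R4' b_le by auto
  have "q (Suc N) * D (Suc N) * (R + 1 - B N - A (Suc N)) = 1"
    using det[of "Suc N"] unfolding q2 D_Suc[of "Suc N"] by (simp add: algebra_simps)
  then have qd: "q (Suc N) * D (Suc N) = 1 / (R + 1 - B N - A (Suc N))"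
    using W by (simp add: field_simps)
  have "\<bar>real_of_int n\<bar> * \<bar>n * A 0 - m - \<gamma>\<bar> =
      (q (Suc N) * D (Suc N)) * \<bar>(0 + i + j * (R + 1 - B N)) * (- \<gamma> / D (Suc N) + i + j * A (Suc N))\<bar>"
    unfolding y unfolding n abs_mult using Q by simp
  also have "\<dots> \<le> (q (Suc N) * D (Suc N)) * ((R - 2) / 4 + e)"
    using Q ij(1) by (intro mult_left_mono) auto
  also have "\<dots> \<le> 1 / (lam - b - 2 * \<eta>) * ((R - 2) / 4 + e)"
    unfolding qd using W e R4' by (intro mult_right_mono divide_left_mono) auto
  finally have 2: "\<bar>real_of_int n\<bar> * \<bar>n * A 0 - m - \<gamma>\<bar> \<le> ((R - 2) / 4 + e) / (lam - b - 2 * \<eta>)" by simp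
  show "\<exists>(n::int) (m::int). \<bar>n * A 0 - m - \<gamma>\<bar> < \<delta> \<and> \<bar>real_of_int n\<bar> * \<bar>n * A 0 - m - \<gamma>\<bar> \<le> ((R - 2) / 4 + e) / (lam - b - 2 * \<eta>)"
    using 1 2 by blast
qed

section \<open>A badly approximable shift\<close>

text \<open>Twice the centre of the cell spanned by the vectors \<open>k\<close> and \<open>k + 1\<close> is \<open>(- Us k, Ws k)\<close>, up to the sign \<open>s\<close> below;
  \<open>U\<close> and \<open>W\<close> are its coordinates relative to the size of the cell.\<close>

definition \<tau> :: "nat \<Rightarrow> int" where "\<tau> k = (if k mod (l + 1) = 0 then 1 else 0)"
definition Us :: "nat \<Rightarrow> int" where "Us k = (\<Sum>i<k. \<tau> i * q (Suc i))"
definition S :: real where "S = (\<Sum>i. \<tau> i * D (Suc i))"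
definition Ws :: "nat \<Rightarrow> real" where "Ws k = S - (\<Sum>i<k. \<tau> i * D (Suc i))"
definition U :: "nat \<Rightarrow> real" where "U k = Us k / q (Suc k)"
definition W :: "nat \<Rightarrow> real" where "W k = Ws k / D k"

lemma a_tau: "a k = R + \<tau> k" and tau_01: "\<tau> k = 0 \<or> \<tau> k = 1"
  by (simp_all add: a_eq \<tau>_def)

lemma tau_block: "0 < k \<Longrightarrow> k \<le> l \<Longrightarrow> \<tau> (c * (l + 1) + k) = 0"
  unfolding \<tau>_def mod_mult_self3 by simp

lemma tau_1_iff: "\<tau> k = 1 \<longleftrightarrow> (\<exists>c. k = c * (l + 1))"
proof
  assume "\<tau> k = 1"
  then have "k mod (l + 1) = 0" unfolding \<tau>_def by (auto split: if_splits)
  then show "\<exists>c. k = c * (l + 1)" by (metis mod_0_imp_dvd dvdE mult.commute)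
next
  assume "\<exists>c. k = c * (l + 1)"
  then show "\<tau> k = 1" unfolding \<tau>_def by (metis mod_mult_self2_is_0)
qed

section \<open>Sizes of the relative coordinates \<open>U\<close> and \<open>W\<close>\<close>

lemma summable_tail: "summable (\<lambda>i. \<tau> (i + k) * D (Suc (i + k)))"
  and suminf_tail: "0 \<le> (\<Sum>i. \<tau> (i + k) * D (Suc (i + k)))" "(\<Sum>i. \<tau> (i + k) * D (Suc (i + k))) \<le> D k"
proof -
  have le: "\<bar>\<tau> (i + k) * D (Suc (i + k))\<bar> \<le> D k * b * b ^ i" for i
  proof -
    have "\<bar>\<tau> (i + k) * D (Suc (i + k))\<bar> \<le> D (Suc (i + k))"
      using tau_01[of "i + k"] D_pos[of "Suc (i + k)"] by (auto simp: abs_mult)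
    also have "\<dots> \<le> b ^ Suc i * D k" using D_le[of k "Suc i"] by (simp add: add.commute)
    finally show ?thesis by (simp add: mult_ac)
  qed
  have sg: "summable (\<lambda>i. D k * b * b ^ i)" using b_pos b_less by (intro summable_mult summable_geometric) auto
  show sm: "summable (\<lambda>i. \<tau> (i + k) * D (Suc (i + k)))"
    by (rule summable_comparison_test[OF _ sg]) (use le in \<open>simp del: power_Suc\<close>)
  show "0 \<le> (\<Sum>i. \<tau> (i + k) * D (Suc (i + k)))"
  proof (rule suminf_nonneg[OF sm])
    show "0 \<le> \<tau> (i + k) * D (Suc (i + k))" for i
      using tau_01[of "i + k"] D_pos[of "Suc (i + k)"] by auto
  qed
  have "(\<Sum>i. \<tau> (i + k) * D (Suc (i + k))) \<le> (\<Sum>i. D k * b * b ^ i)"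
    using le abs_le_D1 by (intro suminf_le[OF _ sm sg]) blast
  also have "\<dots> = D k * (b / (1 - b))" using b_pos b_less
    by (subst suminf_mult) (auto intro: summable_geometric simp: suminf_geometric)
  also have "\<dots> \<le> D k * 1" using b_le D_pos[of k] by (intro mult_left_mono) auto
  finally show "(\<Sum>i. \<tau> (i + k) * D (Suc (i + k))) \<le> D k" by simp
qed

lemma Ws_eq: "Ws k = (\<Sum>i. \<tau> (i + k) * D (Suc (i + k)))"
  using suminf_split_initial_segment[OF summable_tail[of 0, simplified], of k] by (simp add: Ws_def S_def)

lemma W_bounds: "0 \<le> W k" "W k \<le> 1"
  using suminf_tail[of k] D_pos[of k] by (simp_all add: W_def Ws_eq)

lemma W_rec: "W k = A k * (\<tau> k + W (Suc k))"
proof -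
  have "Ws k = \<tau> k * D (Suc k) + Ws (Suc k)" by (simp add: Ws_def)
  then show ?thesis using D_pos[of k] A_pos[of k] by (simp add: W_def D_Suc field_simps)
qed

lemma U_0: "U 0 = 0"
  by (simp add: U_def Us_def)

lemma U_rec: "U (Suc k) = B (Suc k) * (\<tau> k + U k)"
proof -
  have "Us (Suc k) = Us k + \<tau> k * q (Suc k)" by (simp add: Us_def)
  then show ?thesis using q_pos[of k] q_pos[of "Suc k"]
    by (simp add: U_def B_def field_simps del: q_simps)
qed

lemma U_nonneg: "0 \<le> U k"
proof (induction k)
  case (Suc k)
  then show ?case unfolding U_rec using tau_01[of k] B_bounds[of "Suc k"] by auto
qed (simp add: U_0)

text \<open>At a digit R + 1 the bound \<open>b\<close> improves to delta = 1 / (R + 1 - b).\<close>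

lemma A_le_delta: "\<tau> k = 1 \<Longrightarrow> A k \<le> b / (1 + b)"
  and B_le_delta: "\<tau> k = 1 \<Longrightarrow> B (Suc k) \<le> b / (1 + b)"
proof -
  assume \<tau>: "\<tau> k = 1"
  have "1 / (R + 1 - A (Suc k)) \<le> 1 / (R + 1 - b)" "1 / (R + 1 - B k) \<le> 1 / (R + 1 - b)"
    using A_le[of "Suc k"] B_bounds[of k] b_less R4' by (auto intro!: divide_left_mono mult_pos_pos)
  then show "A k \<le> b / (1 + b)" "B (Suc k) \<le> b / (1 + b)"
    using \<tau> unfolding delta_eq by (simp_all add: A_eq[of k] B_Suc a_tau)
qed

lemma U_le: "U k \<le> b"
proof (induction k)
  case (Suc k)
  from tau_01[of k] show ?case
  proof
    assume "\<tau> k = 0"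
    then have "U (Suc k) \<le> b * 1" unfolding U_rec
      using Suc U_nonneg[of k] B_bounds[of "Suc k"] b_less b_pos by (intro mult_mono) auto
    then show ?thesis by simp
  next
    assume \<tau>: "\<tau> k = 1"
    then have "U (Suc k) \<le> b / (1 + b) * (1 + b)" unfolding U_rec
      using Suc U_nonneg[of k] B_bounds[of "Suc k"] B_le_delta b_pos by (intro mult_mono) auto
    then show ?thesis using b_pos by simp
  qed
qed (use U_0 b_pos in simp)

lemma W_le_0: "\<tau> k = 0 \<Longrightarrow> W k \<le> b * W (Suc k)"
  unfolding W_rec[of k] using A_le[of k] W_bounds[of "Suc k"] by (auto intro: mult_right_mono)

lemma U_le_0: "\<tau> k = 0 \<Longrightarrow> U (Suc k) \<le> b * U k"
  unfolding U_rec[of k] using B_bounds[of "Suc k"] U_nonneg[of k] by (auto intro: mult_right_mono)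

lemma tau_Suc: "\<tau> k = 1 \<Longrightarrow> \<tau> (Suc k) = 0"
  using tau_block[of 1] l_pos unfolding tau_1_iff by auto

text \<open>\<open>W\<close> depends on later digits, so the crude bound 1 is improved over one
  step, or over two at a digit 1, which is followed by a 0.\<close>

lemma W_le: "W k \<le> b"
  using tau_01[of k]
proof
  assume "\<tau> k = 0"
  then have "W k \<le> b * W (Suc k)" by (rule W_le_0)
  also have "\<dots> \<le> b * 1" using W_bounds b_pos by (intro mult_left_mono) auto
  finally show ?thesis by simp
next
  assume \<tau>: "\<tau> k = 1"
  have "W (Suc k) \<le> b * W (Suc (Suc k))" by (rule W_le_0[OF tau_Suc[OF \<tau>]])
  also have "\<dots> \<le> b * 1" using W_bounds b_pos by (intro mult_left_mono) auto
  finally have "W k \<le> b / (1 + b) * (1 + b)" unfolding W_rec[of k]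
    using \<tau> W_bounds[of "Suc k"] A_pos[of k] A_le_delta[OF \<tau>] b_pos by (intro mult_mono) auto
  then show ?thesis using b_pos by simp
qed

lemma W_near: "(\<And>i. n \<le> i \<Longrightarrow> i < n + m \<Longrightarrow> \<tau> i = 0) \<Longrightarrow> W n \<le> b ^ m"
proof (induction m arbitrary: n)
  case (Suc m)
  have "W (Suc n) \<le> b ^ m" by (rule Suc.IH) (use Suc.prems in auto)
  then have "b * W (Suc n) \<le> b * b ^ m" using b_pos by (intro mult_left_mono) auto
  then show ?case using W_le_0[of n] Suc.prems by simp
qed (use W_bounds in simp)

lemma U_near: "(\<And>i. n - m \<le> i \<Longrightarrow> i < n \<Longrightarrow> \<tau> i = 0) \<Longrightarrow> m \<le> n \<Longrightarrow> U n \<le> b ^ m"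
proof (induction m arbitrary: n)
  case 0 then show ?case using U_le[of n] b_less by simp
next
  case (Suc m)
  then obtain k where k: "n = Suc k" by (cases n) auto
  have "U k \<le> b ^ m" by (rule Suc.IH) (use Suc.prems k in auto)
  then have "b * U k \<le> b * b ^ m" using b_pos by (intro mult_left_mono) auto
  then show ?case using U_le_0[of k] Suc.prems k by simp
qed

text \<open>A digit 1 has \<open>l\<close> digits 0 after it and also before it, except at the
  start, where \<open>U\<close> vanishes.\<close>

lemma U_small: "\<tau> k = 1 \<Longrightarrow> U k \<le> b ^ l" and W_small: "\<tau> k = 1 \<Longrightarrow> W (Suc k) \<le> b ^ l"
proof -
  assume "\<tau> k = 1"
  then obtain c where k: "k = c * (l + 1)" unfolding tau_1_iff by blast
  show "W (Suc k) \<le> b ^ l"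
  proof (rule W_near)
    fix i assume "Suc k \<le> i" "i < Suc k + l"
    then obtain j where "i = c * (l + 1) + j" unfolding k by (meson Suc_leD le_Suc_ex)
    then show "\<tau> i = 0" using \<open>Suc k \<le> i\<close> \<open>i < Suc k + l\<close> unfolding k by (simp only:) (rule tau_block, auto)
  qed
  show "U k \<le> b ^ l"
  proof (cases c)
    case 0 then show ?thesis using k U_0 b_pos by simp
  next
    case (Suc d)
    show ?thesis
    proof (rule U_near)
      fix i assume i: "k - l \<le> i" "i < k"
      then have "d * (l + 1) \<le> i" unfolding k Suc by simp
      then obtain j where j: "i = d * (l + 1) + j" by (meson le_Suc_ex)
      show "\<tau> i = 0" unfolding j by (rule tau_block) (use i in \<open>auto simp: j k Suc\<close>)
    qed (simp add: k Suc)
  qed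
qed

text \<open>This is four times C(R): with delta = b / (1 + b) it equals (1 - 2 delta) (1 - b) / (1 -
  delta b).\<close>

definition K :: real where "K = (1 - b)\<^sup>2 / (1 + b - b\<^sup>2)"

section \<open>Products at the corners of the cells\<close>

lemma b_sq_le: "b\<^sup>2 \<le> 7/25 * b" "0 < b\<^sup>2"
  using b_le b_pos by (auto simp: power2_eq_square)

lemma K_bounds: "0 < K" "K \<le> (1 - b)\<^sup>2" "K \<le> 1"
proof -
  have 1: "1 \<le> 1 + b - b\<^sup>2" using b_sq_le b_pos by linarith
  show "0 < K" unfolding K_def using 1 b_less by (intro divide_pos_pos) auto
  have "K \<le> (1 - b)\<^sup>2 / 1" unfolding K_def using 1 by (intro divide_left_mono) auto
  then show *: "K \<le> (1 - b)\<^sup>2" by simp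
  have "(1 - b)\<^sup>2 \<le> 1" using b_pos b_less by (simp add: power_le_one)
  then show "K \<le> 1" using * by simp
qed

text \<open>The difference of (1 - 2 x) (1 - y) and K (1 - x y) decreases in x, and at x = delta
  also in y. It vanishes at x = delta, y = b by the choice of \<open>K\<close>, so it is nonnegative
  on the box. The errors in x' and y' cost at most 2 \<open>\<nu>\<close>.\<close>

lemma corner_main:
  fixes x y x' y' \<nu> :: real
  assumes x: "0 \<le> x" "x \<le> b / (1 + b)" and y: "0 \<le> y" "y \<le> b"
    and x': "x' \<ge> 1 - 2 * x - \<nu>" and y': "y' \<ge> 1 - y - \<nu>" "0 \<le> y'" "y' \<le> 1" and \<nu>: "0 \<le> \<nu>"
  shows "x' * y' \<ge> K * (1 - x * y) - 2 * \<nu>"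
proof -
  define d where "d = b / (1 + b)"
  have d: "0 < d" "d \<le> b" "d \<le> 7/25" using b_pos b_le by (auto simp: d_def divide_le_eq)
  have "(1 - 2 * d) * (1 - b) = K * (1 - d * b)"
  proof -
    have 1: "1 - 2 * d = (1 - b) / (1 + b)" "1 - d * b = (1 + b - b\<^sup>2) / (1 + b)"
      using b_pos by (auto simp: d_def field_simps power2_eq_square)
    have "1 + b - b\<^sup>2 \<noteq> 0" using b_sq_le b_pos by linarith
    then show ?thesis unfolding 1 K_def by (simp add: power2_eq_square)
  qed
  moreover have "(d - x) * (2 * (1 - y) - K * y) \<ge> 0"
  proof -
    have "K * y \<le> 1 * y" using K_bounds y by (intro mult_right_mono) auto
    then show ?thesis using x y b_le by (intro mult_nonneg_nonneg) (auto simp: d_def)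
  qed
  moreover have "(b - y) * (1 - 2 * d - K * d) \<ge> 0"
  proof -
    have "K * d \<le> 1 * d" using K_bounds d by (intro mult_right_mono) auto
    then have "1 - 2 * d - K * d \<ge> 0" "b - y \<ge> 0" using y d by linarith+
    then show ?thesis by simp
  qed
  ultimately have main: "(1 - 2 * x) * (1 - y) \<ge> K * (1 - x * y)"
    by (simp add: algebra_simps)
  have x1: "x \<le> 7/25" using x(2) d(3) unfolding d_def by linarith
  have "(1 - 2 * x - \<nu>) * y' \<le> x' * y'" using x' y' by (intro mult_right_mono) auto
  moreover have "(1 - 2 * x) * (1 - y - \<nu>) \<le> (1 - 2 * x) * y'" using y' x1 by (intro mult_left_mono) auto
  moreover have "\<nu> * y' \<le> \<nu> * 1" "(1 - 2 * x) * \<nu> \<le> 1 * \<nu>" using y' \<nu> x by (intro mult_left_mono mult_right_mono; simp)+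
  moreover have "(1 - 2 * x - \<nu>) * y' = (1 - 2 * x) * y' - \<nu> * y'" by (simp add: algebra_simps)
  moreover have "(1 - 2 * x) * (1 - y - \<nu>) = (1 - 2 * x) * (1 - y) - (1 - 2 * x) * \<nu>" by (simp add: algebra_simps)
  ultimately show ?thesis using main by linarith
qed

text \<open>For cells away from the digits R + 1 the worst case is x = y = b, where the claim
  becomes a polynomial inequality in \<open>b\<close> that holds with room to spare.\<close>

lemma corner_plain:
  fixes x y x' y' :: real
  assumes x: "0 \<le> x" "x \<le> b" and y: "0 \<le> y" "y \<le> b"
    and x': "x' \<ge> 1 - x - b\<^sup>2" and y': "y' \<ge> 1 - y - b\<^sup>2"
  shows "x' * y' \<ge> K * (1 - x * y)"
proof -
  have pos: "1 + b - b\<^sup>2 > 0" using b_sq_le b_pos by linarith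
  have "(1 - b - b\<^sup>2)\<^sup>2 * (1 + b - b\<^sup>2) - (1 - b)\<^sup>2 * (1 - b\<^sup>2) = b * (1 - 4 * b + b\<^sup>2 + 5 * b ^ 3 - b ^ 4 - b ^ 5)"
    by (simp add: power2_eq_square power3_eq_cube power_numeral_reduce algebra_simps)
  moreover have "1 - 4 * b + b\<^sup>2 + 5 * b ^ 3 - b ^ 4 - b ^ 5 \<ge> 0"
  proof -
    have "b * b ^ 3 \<le> 7/25 * b ^ 3" using b_le b_pos by (intro mult_right_mono) auto
    then have "b ^ 4 \<le> 7/25 * b ^ 3" by (simp flip: power_Suc)
    moreover have "b ^ 5 \<le> b ^ 4" using b_pos b_less by (intro power_decreasing) auto
    \<comment> \<open>The tangents at 7/25, the upper bound for \<open>b\<close>, bound the square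
      and the cube from below by linear expressions.\<close>
    moreover have "b ^ 3 = (b - 7/25)\<^sup>2 * (b + 14/25) + 147/625 * b - 686/15625" "b\<^sup>2 = (b - 7/25)\<^sup>2 + 14/25 * b - 49/625"
      by (simp_all add: power2_eq_square power3_eq_cube field_simps)
    moreover have "(b - 7/25)\<^sup>2 * (b + 14/25) \<ge> 0" "(b - 7/25)\<^sup>2 \<ge> 0" "0 < b ^ 3" using b_pos by auto
    ultimately show ?thesis using b_le by linarith
  qed
  ultimately have "(1 - b)\<^sup>2 * (1 - b\<^sup>2) \<le> (1 - b - b\<^sup>2)\<^sup>2 * (1 + b - b\<^sup>2)" 
  proof -
    assume *: "(1 - b - b\<^sup>2)\<^sup>2 * (1 + b - b\<^sup>2) - (1 - b)\<^sup>2 * (1 - b\<^sup>2) = b * (1 - 4 * b + b\<^sup>2 + 5 * b ^ 3 - b ^ 4 - b ^ 5)"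
      and "1 - 4 * b + b\<^sup>2 + 5 * b ^ 3 - b ^ 4 - b ^ 5 \<ge> 0"
    then have "0 \<le> b * (1 - 4 * b + b\<^sup>2 + 5 * b ^ 3 - b ^ 4 - b ^ 5)" using b_pos by simp
    then show ?thesis using * by linarith
  qed
  then have G: "K * (1 - b * b) \<le> (1 - b - b\<^sup>2) * (1 - b - b\<^sup>2)" using pos by (simp add: K_def divide_le_eq power2_eq_square)
  have Ky: "K * z \<le> z" if "0 \<le> z" for z using K_bounds that mult_right_mono[of K 1 z] by simp
  have "(b - x) * (1 - y - b\<^sup>2 - K * y) \<ge> 0" 
    by (intro mult_nonneg_nonneg) (use x y Ky[OF y(1)] b_le b_sq_le in linarith)+
  moreover have "(b - y) * (1 - b - b\<^sup>2 - K * b) \<ge> 0" 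
    by (intro mult_nonneg_nonneg) (use x y Ky[of b] b_pos b_le b_sq_le in linarith)+
  ultimately have "K * (1 - x * y) \<le> (1 - x - b\<^sup>2) * (1 - y - b\<^sup>2)" using G by (simp add: algebra_simps)
  also have "\<dots> \<le> x' * y'" using x' y' x y b_le b_sq_le by (intro mult_mono) auto
  finally show ?thesis .
qed

text \<open>Right after a digit R + 1, \<open>U\<close> is nearly \<open>B\<close> and
  \<open>W\<close> is at most \<open>b ^ l\<close>; right before it, \<open>W\<close> is nearly
  \<open>A\<close> and \<open>U\<close> is small. This produces the factor 1 - 2 x of
  \<open>corner_main\<close>. Elsewhere both are at most \<open>b\<^sup>2\<close>.\<close>

lemma corner: "(1 - B k - U k) * (1 - A k - W k) \<ge> K * (1 - A k * B k) - 2 * b ^ l"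
proof -
  have \<nu>: "0 \<le> b ^ l" using b_pos by simp
  note bounds = A_pos[of k] A_le[of k] B_bounds[of k] U_nonneg[of k] U_le[of k] W_bounds[of k] W_le[of k] b_le
  consider (post) j where "k = Suc j" "\<tau> j = 1" | (pre) "\<tau> k = 1"
    | (none) "\<tau> k = 0" "k = 0 \<or> (\<exists>j. k = Suc j \<and> \<tau> j = 0)"
    using tau_01 by (cases k) metis+
  then show ?thesis
  proof cases
    case post
    have "U k \<le> B k + b ^ l"
    proof -
      have "B k * U j \<le> 1 * b ^ l" using bounds U_small[OF post(2)] U_nonneg[of j] by (intro mult_mono) auto
      then show ?thesis using post by (simp add: U_rec algebra_simps)
    qed
    moreover have "W k \<le> b ^ l" using W_small post by simp
    moreover have "B k \<le> b / (1 + b)" using B_le_delta post by simp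
    ultimately have "K * (1 - B k * A k) - 2 * b ^ l \<le> (1 - B k - U k) * (1 - A k - W k)"
      using bounds \<nu> by (intro corner_main) linarith+
    then show ?thesis by (simp only: mult.commute)
  next
    case pre
    have "W k \<le> A k + b ^ l"
    proof -
      have "A k * W (Suc k) \<le> 1 * b ^ l" using bounds W_small[OF pre] W_bounds[of "Suc k"] by (intro mult_mono) auto
      then show ?thesis using pre by (simp add: W_rec[of k] algebra_simps)
    qed
    moreover have "U k \<le> b ^ l" using U_small pre by simp
    moreover have "A k \<le> b / (1 + b)" using A_le_delta pre by simp
    ultimately have "K * (1 - A k * B k) - 2 * b ^ l \<le> (1 - A k - W k) * (1 - B k - U k)"
      using bounds \<nu> by (intro corner_main) linarith+
    then show ?thesis by (simp only: mult.commute)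
  next
    case none
    have "W k \<le> b * W (Suc k)" by (rule W_le_0[OF none(1)])
    also have "\<dots> \<le> b * b" using W_le b_pos by (intro mult_left_mono) auto
    finally have "W k \<le> b\<^sup>2" by (simp add: power2_eq_square)
    moreover have "U k \<le> b\<^sup>2" using none(2)
    proof
      assume "\<exists>j. k = Suc j \<and> \<tau> j = 0"
      then obtain j where j: "k = Suc j" "\<tau> j = 0" by blast
      have "U k \<le> b * U j" unfolding j(1) by (rule U_le_0[OF j(2)])
      also have "\<dots> \<le> b * b" using U_le b_pos by (intro mult_left_mono) auto
      finally show ?thesis by (simp add: power2_eq_square)
    qed (simp add: U_0)
    ultimately have "K * (1 - B k * A k) \<le> (1 - B k - U k) * (1 - A k - W k)"
      using bounds by (intro corner_plain) auto
    then show ?thesis using \<nu> by (simp add: mult.commute)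
  qed
qed


section \<open>The polygonal line through the corners and the points beyond it\<close>

lemma qD_bounds: "0 < q (Suc k) * D k" "q (Suc k) * D k \<ge> 1" "q (Suc k) * D k \<le> 2"
proof -
  show 0: "0 < q (Suc k) * D k" using q_pos[of k] D_pos[of k] by simp
  have "A k * B k \<le> 1/2 * 1" using A_pos[of k] A_le[of k] B_bounds[of k] b_le by (intro mult_mono) auto
  then have "q (Suc k) * D k * (1/2) \<le> q (Suc k) * D k * (1 - A k * B k)" using 0 by (intro mult_left_mono) auto
  then show "q (Suc k) * D k \<le> 2" unfolding qD by simp
  have "A k * B k \<ge> 0" using A_pos[of k] B_bounds[of k] by simp
  then have "q (Suc k) * D k * (1 - A k * B k) \<le> q (Suc k) * D k * 1" using 0 by (intro mult_left_mono) auto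
  then show "q (Suc k) * D k \<ge> 1" unfolding qD by simp
qed

text \<open>Twice the corner of cell \<open>k\<close> in the fourth quadrant is \<open>(ec s k, - fc s k)\<close>.\<close>

definition ec :: "int \<Rightarrow> nat \<Rightarrow> real" where "ec s k = q (Suc k) - q k - s * Us k"
definition fc :: "int \<Rightarrow> nat \<Rightarrow> real" where "fc s k = D k - D (Suc k) - s * Ws k"

lemma ec_eq: "ec s k = q (Suc k) * (1 - B k - s * U k)"
  and fc_eq: "fc s k = D k * (1 - A k - s * W k)"
  using q_pos[of k] D_pos[of k] by (simp_all add: ec_def fc_def B_def U_def W_def D_Suc field_simps)

lemma ec_Suc: "ec s (Suc k) = ec s k + (a k - 2 - s * \<tau> k) * q (Suc k)"
  by (simp add: ec_def Us_def algebra_simps)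

lemma fc_Suc: "fc s (Suc k) = fc s k - (a k - 2 - s * \<tau> k) * D (Suc k)"
  by (simp add: fc_def Ws_def D_simps algebra_simps)

text \<open>Since \<open>U\<close> and \<open>W\<close> are nonnegative, s = 1 is the worse sign. In
  \<open>corner\<close>, the factor \<open>1 - A k * B k\<close> cancels against the scale by
  \<open>qD\<close>, and the error at most doubles.\<close>

lemma corner_bounds:
  assumes s: "s = 1 \<or> s = (-1::int)"
  shows "0 < ec s k" "0 < fc s k" "ec s k * fc s k \<ge> K - 4 * b ^ l"
proof -
  note bounds = A_pos[of k] A_le[of k] B_bounds[of k] U_nonneg[of k] U_le[of k] W_bounds[of k] W_le[of k] b_le
  have 1: "1 - B k - U k \<le> 1 - B k - s * U k" "1 - A k - W k \<le> 1 - A k - s * W k" using s bounds by auto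
  have 2: "0 < 1 - B k - U k" "0 < 1 - A k - W k" using bounds by auto
  show "0 < ec s k" "0 < fc s k" unfolding ec_eq fc_eq using 1 2 q_pos[of k] D_pos[of k] by (auto intro!: mult_pos_pos)
  have "K - 4 * b ^ l \<le> q (Suc k) * D k * (K * (1 - A k * B k) - 2 * b ^ l)"
  proof -
    have "q (Suc k) * D k * (K * (1 - A k * B k) - 2 * b ^ l) = K * (q (Suc k) * D k * (1 - A k * B k)) - 2 * b ^ l * (q (Suc k) * D k)"
      by (simp add: algebra_simps)
    moreover have "2 * b ^ l * (q (Suc k) * D k) \<le> 2 * b ^ l * 2" using qD_bounds[of k] b_pos by (intro mult_left_mono) auto
    ultimately show ?thesis unfolding qD by simp
  qed
  also have "\<dots> \<le> q (Suc k) * D k * ((1 - B k - U k) * (1 - A k - W k))"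
    using qD_bounds[of k] by (intro mult_left_mono corner) auto
  also have "\<dots> \<le> q (Suc k) * D k * ((1 - B k - s * U k) * (1 - A k - s * W k))"
    using 1 2 qD_bounds[of k] by (intro mult_left_mono mult_mono) auto
  also have "\<dots> = ec s k * fc s k" unfolding ec_eq fc_eq by simp
  finally show "ec s k * fc s k \<ge> K - 4 * b ^ l" .
qed

text \<open>This makes the polygonal line extend beyond every abscissa.\<close>

lemma ec_unbounded:
  assumes s: "s = 1 \<or> s = (-1::int)"
  shows "ec s k \<ge> 1 + real k"
proof (induction k)
  case (Suc k)
  have "a k - 2 - s * \<tau> k \<ge> 1" using a_ge[of k] R4 tau_01[of k] s by auto
  moreover have "q (Suc k) \<ge> 1" using q_pos[of k] by linarith
  ultimately have "1 * 1 \<le> (a k - 2 - s * \<tau> k) * q (Suc k)" by (intro mult_mono) auto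
  then have "1 \<le> real_of_int ((a k - 2 - s * \<tau> k) * q (Suc k))" by linarith
  then show ?case using Suc unfolding ec_Suc by simp
qed (simp add: ec_def Us_def)

text \<open>Here \<open>(x, y)\<close> is twice a point of the shifted lattice; the sign \<open>s\<close> reflects points with
  negative first coordinate into the right half plane.\<close>

definition rep :: "int \<Rightarrow> real \<Rightarrow> real \<Rightarrow> nat \<Rightarrow> int \<Rightarrow> int \<Rightarrow> bool" where
  "rep s x y k i j \<longleftrightarrow> odd i \<and> odd j \<and> x = real_of_int i * q (Suc k) + real_of_int j * q k - real_of_int s * Us k
     \<and> y = i * D (Suc k) + j * D k + s * Ws k"

text \<open>The coefficients change by V_k = a_k V_(k+1) - V_(k+2). They stay odd because
  \<open>a k\<close> and \<open>\<tau> k\<close> have the same parity, R being even; hence the digit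
  1 exactly at R + 1.\<close>

lemma rep_Suc:
  assumes s: "s = 1 \<or> s = (-1::int)" and r: "rep s x y k i j"
  shows "rep s x y (Suc k) (- j) (i + j * a k + s * \<tau> k)"
proof -
  have "odd (i + j * a k + s * \<tau> k)"
    using r s even_R tau_01[of k] by (auto simp: rep_def a_tau)
  then show ?thesis using r unfolding rep_def
    by (simp add: Us_def Ws_def D_simps algebra_simps)
qed

text \<open>With two positive coefficients each coordinate is at least 1 - b in the scale of the
  cell, and \<open>K \<le> (1 - b)\<^sup>2\<close>.\<close>

lemma rep_diag:
  assumes s: "s = 1 \<or> s = (-1::int)" and r: "rep s x y k i j" and ij: "i \<ge> 1" "j \<ge> 1"
  shows "\<bar>x * y\<bar> \<ge> K"
proof -
  note bounds = A_pos[of k] A_le[of k] B_bounds[of k] U_nonneg[of k] U_le[of k] W_bounds[of k] W_le[of k] b_le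
  have Q: "0 < real_of_int (q (Suc k))" "0 < D k" using q_pos D_pos by auto
  have "q (Suc k) * B k = q k" "q (Suc k) * U k = Us k" "D k * W k = Ws k"
    using Q by (simp_all add: B_def U_def W_def)
  then have x: "x = q (Suc k) * (i + j * B k - s * U k)" and y: "y = D k * (i * A k + j + s * W k)"
    using r by (simp_all add: rep_def D_Suc algebra_simps)
  have "1 \<le> real_of_int i" "1 \<le> real_of_int j" using ij by simp_all
  moreover have "0 \<le> j * B k" "0 \<le> i * A k" using ij bounds by auto
  moreover have "s * U k \<le> b" "- b \<le> s * W k" using s bounds b_pos by auto
  ultimately have 1: "1 - b \<le> i + j * B k - s * U k" "1 - b \<le> i * A k + j + s * W k" by linarith+
  have p: "(1 - b) * (1 - b) \<le> (i + j * B k - s * U k) * (i * A k + j + s * W k)"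
    using 1 b_less by (intro mult_mono) auto
  have "1 * ((1 - b) * (1 - b)) \<le> q (Suc k) * D k * ((i + j * B k - s * U k) * (i * A k + j + s * W k))"
    by (rule mult_mono) (use qD_bounds[of k] b_less p in auto)
  also have "\<dots> = x * y" unfolding x y by simp
  finally show ?thesis using K_bounds by (simp add: power2_eq_square)
qed

text \<open>Along a segment of negative slope the product of the coordinates is concave.\<close>

lemma segment_product:
  fixes e f q d \<theta> g c :: real
  assumes "0 \<le> \<theta>" "\<theta> \<le> g" "0 \<le> q" "0 \<le> d" "c \<le> e * f" "c \<le> (e + g * q) * (f - g * d)"
  shows "c \<le> (e + \<theta> * q) * (f - \<theta> * d)"
proof (cases "g = 0")
  case True then show ?thesis using assms by simp
next
  case False
  then have g: "0 < g" using assms by simp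
  have "g * ((e + \<theta> * q) * (f - \<theta> * d)) = (g - \<theta>) * (e * f) + \<theta> * ((e + g * q) * (f - g * d)) + g * (q * d * \<theta> * (g - \<theta>))"
    by (simp add: algebra_simps)
  moreover have "(g - \<theta>) * c \<le> (g - \<theta>) * (e * f)" "\<theta> * c \<le> \<theta> * ((e + g * q) * (f - g * d))"
    using assms by (auto intro: mult_left_mono)
  moreover have "0 \<le> g * (q * d * \<theta> * (g - \<theta>))" using assms g by simp
  ultimately have "(g - \<theta>) * c + \<theta> * c \<le> g * ((e + \<theta> * q) * (f - \<theta> * d))" by linarith
  then have "g * c \<le> g * ((e + \<theta> * q) * (f - \<theta> * d))" by (simp add: algebra_simps)
  then show ?thesis using g by simp
qed

text \<open>The point lies below the polygonal line through the corners, hence vertically below the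
  segment between the corners \<open>k\<close> and \<open>k + 1\<close> for a suitable \<open>k\<close>.\<close>

lemma rep_off_diag:
  assumes s: "s = 1 \<or> s = (-1::int)"
    and r: "\<And>k. \<exists>i j. rep s x y k i j \<and> i \<ge> 1 \<and> j \<le> -1" and x: "x \<ge> 1"
  shows "\<bar>x * y\<bar> \<ge> K - 4 * b ^ l"
proof -
  define n where "n = (LEAST n. x < ec s n)"
  have "x < ec s (nat \<lceil>x\<rceil>)" using ec_unbounded[OF s, of "nat \<lceil>x\<rceil>"] x by linarith
  then have n: "x < ec s n" unfolding n_def by (rule LeastI)
  have "ec s 0 = 1" by (simp add: ec_def Us_def)
  then obtain k where k: "n = Suc k" using n x by (cases n) auto
  then have ek: "ec s k \<le> x" using not_less_Least[of k "\<lambda>n. x < ec s n"] unfolding n_def[symmetric] by simp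
  obtain i j where ij: "rep s x y k i j" "i \<ge> 1" "j \<le> -1" using r by blast
  define g where "g = real_of_int (a k - 2 - s * \<tau> k)"
  define \<theta> where "\<theta> = (x - ec s k) / q (Suc k)"
  have Q: "0 < real_of_int (q (Suc k))" "0 < D k" "0 < D (Suc k)" using q_pos D_pos by auto
  have xe: "x = ec s k + \<theta> * q (Suc k)" using Q by (simp add: \<theta>_def)
  have \<theta>: "0 \<le> \<theta>" "\<theta> \<le> g"
  proof -
    show "0 \<le> \<theta>" using ek Q by (simp add: \<theta>_def)
    have "x - ec s k \<le> g * q (Suc k)" using n unfolding k ec_Suc g_def by simp
    then show "\<theta> \<le> g" using Q by (simp add: \<theta>_def divide_le_eq)
  qed
  have "fc s k - \<theta> * D (Suc k) \<le> - y"
  proof -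
    \<comment> \<open>The corner has the coefficients 1 and -1. Equal abscissae determine
      \<open>\<theta>\<close> from i and j, and then the ordinates differ by -(j + 1) times a
      positive quantity.\<close>
    have "(i - 1) * q (Suc k) + (j + 1) * q k = \<theta> * q (Suc k)"
      using ij(1) xe by (simp add: rep_def ec_def algebra_simps)
    then have "\<theta> * q (Suc k) = ((i - 1) + (j + 1) * B k) * q (Suc k)"
    proof -
      have "B k * q (Suc k) = q k" using Q by (simp add: B_def)
      then show ?thesis using \<open>_ = \<theta> * q (Suc k)\<close> by (simp add: distrib_right mult.assoc)
    qed
    then have \<theta>': "\<theta> = (i - 1) + (j + 1) * B k" using Q by simp
    have "- y - (fc s k - \<theta> * D (Suc k)) = - real_of_int (j + 1) * (D k * (1 - A k * B k))"
      using ij(1) unfolding \<theta>' by (simp add: rep_def fc_def D_Suc algebra_simps)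
    moreover have "0 \<le> - real_of_int (j + 1) * (D k * (1 - A k * B k))"
    proof -
      have "A k * B k \<le> 1 * 1" using A_pos[of k] A_le[of k] B_bounds[of k] b_less by (intro mult_mono) auto
      then show ?thesis using ij(3) Q by (intro mult_nonneg_nonneg) auto
    qed
    ultimately show ?thesis by linarith
  qed
  then have "x * (fc s k - \<theta> * D (Suc k)) \<le> x * (- y)" using x by (intro mult_left_mono) auto
  moreover have "K - 4 * b ^ l \<le> (ec s k + \<theta> * q (Suc k)) * (fc s k - \<theta> * D (Suc k))"
  proof (rule segment_product[OF \<theta>])
    show "K - 4 * b ^ l \<le> ec s k * fc s k" by (rule corner_bounds(3)[OF s])
    show "K - 4 * b ^ l \<le> (ec s k + g * q (Suc k)) * (fc s k - g * D (Suc k))"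
      using corner_bounds(3)[OF s, of "Suc k"] unfolding ec_Suc fc_Suc g_def of_int_mult .
  qed (use Q in \<open>simp_all only: less_imp_le\<close>)
  ultimately show ?thesis unfolding xe[symmetric] by linarith
qed

text \<open>The point is followed through the successive bases. If both coefficients are positive in
  one of them, \<open>rep_diag\<close> applies. Otherwise their signs are (+, -) in every basis,
  since the next leading coefficient is \<open>- j\<close>, and \<open>rep_off_diag\<close>
  applies.\<close>

lemma grid_lower:
  assumes s: "s = 1 \<or> s = (-1::int)" and i: "odd i" "i \<ge> 1" and j: "odd j"
  shows "\<bar>real_of_int i * (i * A 0 + j + s * S)\<bar> \<ge> K - 4 * b ^ l"
proof -
  define x y where "x = real_of_int i" and "y = i * A 0 + j + s * S"
  have r0: "rep s x y 0 i j" using i j by (simp add: rep_def x_def y_def Us_def Ws_def D_simps)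
  show ?thesis
  proof (cases "\<exists>k i j. rep s x y k i j \<and> i \<ge> 1 \<and> j \<ge> 1")
    case True
    then have "\<bar>x * y\<bar> \<ge> K" using rep_diag[OF s] by blast
    moreover have "0 < b ^ l" using b_pos by simp
    ultimately show ?thesis unfolding x_def y_def by linarith
  next
    case False
    have odd_neg: "j \<le> -1" if "rep s x y k i j" "i \<ge> 1" for k i j
    proof -
      have "odd j" using that by (simp add: rep_def)
      then have "j \<noteq> 0" by auto
      moreover have "\<not> j \<ge> 1" using False that by blast
      ultimately show ?thesis by linarith
    qed
    have "\<exists>i j. rep s x y k i j \<and> i \<ge> 1 \<and> j \<le> -1" for k
    proof (induction k)
      case 0 then show ?case using r0 i odd_neg by blast
    next
      case (Suc k)
      then obtain i j where ij: "rep s x y k i j" "i \<ge> 1" "j \<le> -1" by blast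
      note r = rep_Suc[OF s ij(1)]
      have "- j \<ge> 1" using ij by simp
      then show ?case using r odd_neg[OF r] by blast
    qed
    then have "\<bar>x * y\<bar> \<ge> K - 4 * b ^ l" using i by (intro rep_off_diag[OF s]) (auto simp: x_def)
    then show ?thesis unfolding x_def y_def .
  qed
qed

text \<open>Doubling the points after moving them by 1/2 in the first coordinate gives odd
  coefficients, hence 2 n + 1. For negative n the point is negated, which reverses the sign of
  \<open>S\<close>.\<close>

lemma gamma_lower:
  fixes n m :: int
  defines "\<gamma> \<equiv> - (1 + A 0 + S) / 2"
  shows "\<bar>2 * real_of_int n + 1\<bar> * \<bar>n * A 0 - m - \<gamma>\<bar> \<ge> (K - 4 * b ^ l) / 2"
proof -
  have eq: "2 * (n * A 0 - m - \<gamma>) = (2 * n + 1) * A 0 + (1 - 2 * m) + S" by (simp add: \<gamma>_def field_simps)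
  have "K - 4 * b ^ l \<le> \<bar>(2 * real_of_int n + 1) * (2 * (n * A 0 - m - \<gamma>))\<bar>"
  proof (cases "n \<ge> 0")
    case True
    then show ?thesis using grid_lower[of 1 "2 * n + 1" "1 - 2 * m"] unfolding eq by simp
  next
    case False
    then have "K - 4 * b ^ l \<le> \<bar>real_of_int (- 2 * n - 1) * (real_of_int (- 2 * n - 1) * A 0 + real_of_int (2 * m - 1) + real_of_int (-1) * S)\<bar>"
      by (intro grid_lower) auto
    also have "\<dots> = \<bar>(2 * real_of_int n + 1) * (2 * (n * A 0 - m - \<gamma>))\<bar>"
      unfolding eq by (rule arg_cong[where f = abs]) (simp add: algebra_simps)
    finally show ?thesis .
  qed
  also have "\<dots> = 2 * (\<bar>2 * real_of_int n + 1\<bar> * \<bar>n * A 0 - m - \<gamma>\<bar>)" unfolding abs_mult by simp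
  finally show ?thesis by simp
qed

lemma rho_lower:
  fixes e :: real
  assumes pos: "4 * b ^ l < K" and e: "0 < e"
  shows "rho (A 0) \<ge> ereal (K / 4 - b ^ l - e)"
proof -
  define \<gamma> where "\<gamma> = - (1 + A 0 + S) / 2"
  have low: "(K - 4 * b ^ l) / 2 \<le> \<bar>2 * real_of_int n + 1\<bar> * \<bar>n * A 0 - m - \<gamma>\<bar>" for n m :: int
    using gamma_lower[of n m] unfolding \<gamma>_def .
  have "\<not> (\<exists>m k::int. \<gamma> = real_of_int m + A 0 * real_of_int k)"
  proof
    assume "\<exists>m k::int. \<gamma> = real_of_int m + A 0 * real_of_int k"
    then obtain m k :: int where "\<gamma> = real_of_int m + A 0 * real_of_int k" by blast
    then have "k * A 0 - real_of_int m - \<gamma> = 0 \<or> k * A 0 - real_of_int (- m) - \<gamma> = 0" by (simp add: algebra_simps)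
    then show False using low[of k m] low[of k "- m"] pos by auto
  qed
  then have "M_inhom (A 0) \<gamma> \<le> rho (A 0)" unfolding rho_def by (intro SUP_upper) blast
  moreover have "ereal (K / 4 - b ^ l - e) \<le> M_inhom (A 0) \<gamma>"
    unfolding M_inhom_def
  proof (rule Liminf_bounded)
    have "K / 4 - b ^ l - e \<le> \<bar>real_of_int n\<bar> * nint_dist (n * A 0 - \<gamma>)" if n: "1 / e \<le> \<bar>real_of_int n\<bar>" for n :: int
    proof -
      obtain m :: int where m: "nint_dist (n * A 0 - \<gamma>) = \<bar>n * A 0 - \<gamma> - m\<bar>" using nint_dist_eq by blast
      define v where "v = \<bar>n * A 0 - \<gamma> - m\<bar>"
      have v: "(K - 4 * b ^ l) / 2 \<le> \<bar>2 * real_of_int n + 1\<bar> * v" using low[of n m] by (simp add: v_def algebra_simps)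
      define N where "N = \<bar>real_of_int n\<bar>"
      have N: "1 \<le> N * e" "0 < N"
      proof -
        show "1 \<le> N * e" using n e unfolding N_def[symmetric] by (simp add: divide_le_eq)
        have "0 < 1 / e" using e by simp
        then show "0 < N" using n unfolding N_def[symmetric] by linarith
      qed
      have v0: "0 \<le> v" by (simp add: v_def)
      have "\<bar>2 * real_of_int n + 1\<bar> * v \<le> (2 * N + 1) * v" using v0 by (intro mult_right_mono) (auto simp: N_def)
      then have A: "(K - 4 * b ^ l) / 2 \<le> (2 * N + 1) * v" using v by linarith
      show ?thesis
      \<comment> \<open>Passing from 2 |n| + 1 to 2 |n| costs v / 2 after halving, at most
        \<open>e\<close> for small v. For large v the product is at least 2, as
        \<open>1 \<le> N * e\<close>.\<close>
      proof (cases "v \<le> 2 * e")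
        case True
        then have "(2 * N + 1) * v = 2 * (N * v) + v" by (simp add: algebra_simps)
        then have "K / 4 - b ^ l \<le> N * v + e" using A True by (simp add: field_simps)
        then show ?thesis unfolding m N_def v_def by linarith
      next
        case False
        then have "N * (2 * e) \<le> N * v" using N by (intro mult_left_mono) auto
        moreover have "0 < b ^ l" using b_pos by simp
        ultimately have "K / 4 - b ^ l - e \<le> N * v" using N K_bounds e by linarith
        then show ?thesis unfolding m N_def v_def .
      qed
    qed
    note low' = this
    have "{n::int. \<not> ereal (K / 4 - b ^ l - e) \<le> ereal (\<bar>real_of_int n\<bar> * nint_dist (n * A 0 - \<gamma>))} \<subseteq> {- \<lceil>1 / e\<rceil>..\<lceil>1 / e\<rceil>}"
    proof
      fix n assume "n \<in> {n::int. \<not> ereal (K / 4 - b ^ l - e) \<le> ereal (\<bar>real_of_int n\<bar> * nint_dist (n * A 0 - \<gamma>))}"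
      then have "\<not> 1 / e \<le> \<bar>real_of_int n\<bar>" using low'[of n] by auto
      then show "n \<in> {- \<lceil>1 / e\<rceil>..\<lceil>1 / e\<rceil>}" by (simp, linarith)
    qed
    then show "\<forall>\<^sub>F n in cofinite. ereal (K / 4 - b ^ l - e) \<le> ereal (\<bar>real_of_int n\<bar> * nint_dist (n * A 0 - \<gamma>))"
      unfolding eventually_cofinite by (rule finite_subset) simp
  qed
  ultimately show ?thesis by (rule order_trans[rotated])
qed

end

section \<open>The limit\<close>

lemma (in ncf) rho_upper:
  fixes \<eta> e M :: real
  assumes "(1/3) ^ l \<le> \<eta>" "\<eta> \<le> 1" "0 < e"
    and "\<And>(r::real) (t::real) (x::real) (y::real). \<bar>r - lam\<bar> \<le> \<eta> \<Longrightarrow> \<bar>t - b\<bar> \<le> \<eta> \<Longrightarrow>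
    (\<exists>(i::int) (j::int). \<bar>(x + i + j * r) * (y + i + j * t)\<bar> \<le> (R - 2) / 4 + e \<and> \<bar>y + i + j * t\<bar> \<le> M)"
  shows "rho (A 0) \<le> ereal (((R - 2) / 4 + e) / (lam - b - 2 * \<eta>))"
  unfolding rho_def using assms by (intro SUP_least M_inhom_upper[of \<eta> e M]) auto

theorem theorem2:
  fixes R :: int and \<alpha> :: "nat \<Rightarrow> real"
  assumes "R \<ge> 4" and "even R"
    and "\<And>l. l \<ge> 1 \<Longrightarrow> 0 < \<alpha> l \<and> \<alpha> l < 1"
    and "\<And>l n. l \<ge> 1 \<Longrightarrow>
           ncf_digit (\<alpha> l) n = (if n mod (l + 1) = 0 then R + 1 else R)"
  shows "let \<beta> = (real_of_int R - sqrt (real_of_int R ^ 2 - 4)) / 2;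
             \<delta> = 1 / (real_of_int R + 1 - \<beta>);
             C = (1 - 2 * \<delta>) * (1 - \<beta>) / (4 * (1 - \<delta> * \<beta>))
         in ((\<lambda>l. rho (\<alpha> (l + 1))) \<longlonglongrightarrow> ereal C) \<and>
            C = (1 / 4) * ((real_of_int R - 2) / (sqrt (real_of_int R ^ 2 - 4) + 1))"
proof -
  define b where "b = (real_of_int R - sqrt (real_of_int R ^ 2 - 4)) / 2"
  define K where "K = (1 - b)\<^sup>2 / (1 + b - b\<^sup>2)"
  have R: "real_of_int R \<ge> 4" using assms(1) by linarith
  have R2: "real_of_int R ^ 2 \<ge> 4 ^ 2" using R by (intro power_mono) auto
  define z where "z = sqrt (real_of_int R ^ 2 - 4)"
  have z2: "z\<^sup>2 = real_of_int R ^ 2 - 4" using R2 by (simp add: z_def)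
  have z0: "0 \<le> z" using R2 by (simp add: z_def)
  have z: "z < R" "R - 2 < z"
  proof -
    show "z < R" by (rule power2_less_imp_less) (use R z2 in auto)
    have "(real_of_int R - 2)\<^sup>2 < z\<^sup>2" using R unfolding z2 by (simp add: power2_eq_square algebra_simps)
    then show "R - 2 < z" using z0 by (simp add: power2_less_imp_less)
  qed
  interpret quad_root R b
  proof
    show "4 \<le> R" "even R" by fact+
    show "0 < b" "b < 1" using z by (auto simp: b_def simp flip: z_def)
    have "b * (R - b) = ((real_of_int R)\<^sup>2 - z\<^sup>2) / 4"
      unfolding b_def z_def[symmetric] by (simp add: power2_eq_square field_simps)
    then show "b * (R - b) = 1" unfolding z2 by simp
  qed
  have zb: "z = R - 2 * b" by (simp add: b_def z_def field_simps)
  have W: "lam - b = z + 1" using lam_eq zb by simp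
  define C where "C = K / 4"
  have C1: "C = (1 / 4) * ((real_of_int R - 2) / (z + 1))"
  proof -
    have "(1 - b)\<^sup>2 / b / ((1 + b - b\<^sup>2) / b) = K" using b_pos by (simp add: K_def)
    moreover have "(1 + b - b\<^sup>2) / b = z + 1" unfolding W[symmetric] lam_def
      using b_pos by (simp add: field_simps power2_eq_square)
    ultimately show ?thesis unfolding R_minus_2 C_def by simp
  qed
  have C2: "C = (1 - 2 * (1 / (real_of_int R + 1 - b))) * (1 - b) / (4 * (1 - 1 / (real_of_int R + 1 - b) * b))"
  proof -
    have d: "1 / (real_of_int R + 1 - b) = b / (1 + b)" using delta_eq by simp
    have 1: "1 - 2 * (b / (1 + b)) = (1 - b) / (1 + b)" "1 - b / (1 + b) * b = (1 + b - b\<^sup>2) / (1 + b)"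
      using b_pos by (auto simp: field_simps power2_eq_square)
    show ?thesis unfolding d 1 C_def K_def using b_pos by (simp add: power2_eq_square)
  qed
  have ncf: "ncf R b l (ncf_rem (\<alpha> l)) (ncf_digit (\<alpha> l))" if l: "l \<ge> 1" for l
  proof
    show "1 \<le> l" by fact
    have dig: "ncf_digit (\<alpha> l) n = (if n mod (l + 1) = 0 then R + 1 else R)" for n using assms(4) l by blast
    then show "ncf_digit (\<alpha> l) n = (if n mod (l + 1) = 0 then R + 1 else R)" for n .
    show "ncf_rem (\<alpha> l) (Suc n) = ncf_digit (\<alpha> l) n - 1 / ncf_rem (\<alpha> l) n" for n
      by (simp add: ncf_digit_def)
    have "0 < ncf_rem (\<alpha> l) n \<and> ncf_rem (\<alpha> l) n < 1" for n
    proof (induction n)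
      case 0 then show ?case using assms(3) l by simp
    next
      case (Suc n)
      \<comment> \<open>As 1 / 0 = 0, a vanishing remainder would produce the digit 0, but all
        digits are at least R.\<close>
      have "ncf_digit (\<alpha> l) (Suc n) \<noteq> 0" using dig[of "Suc n"] assms(1) by simp
      then have "ncf_rem (\<alpha> l) (Suc n) \<noteq> 0" by (auto simp: ncf_digit_def simp del: ncf_rem.simps)
      moreover have "0 \<le> ncf_rem (\<alpha> l) (Suc n)" "ncf_rem (\<alpha> l) (Suc n) < 1"
        using ceiling_correct[of "1 / ncf_rem (\<alpha> l) n"] unfolding ncf_rem.simps by linarith+
      ultimately show ?case by linarith
    qed
    then show "0 < ncf_rem (\<alpha> l) n" "ncf_rem (\<alpha> l) n < 1" for n by auto
  qed
  have upper: "\<forall>\<^sub>F l in sequentially. rho (\<alpha> (l + 1)) \<le> ereal (C + e)" if e: "0 < e" for e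
  proof -
    obtain \<eta>0 M where \<eta>0: "\<eta>0 > 0" and cov: "\<forall>(r::real) (t::real) (x::real) (y::real). \<bar>r - lam\<bar> \<le> \<eta>0 \<longrightarrow> \<bar>t - b\<bar> \<le> \<eta>0 \<longrightarrow>
      (\<exists>(i::int) (j::int). \<bar>(x + i + j * r) * (y + i + j * t)\<bar> \<le> (R - 2) / 4 + e \<and> \<bar>y + i + j * t\<bar> \<le> M)"
      using covering_near[OF e] by blast
    define \<eta> where "\<eta> = min \<eta>0 (min e 1)"
    have \<eta>: "0 < \<eta>" "\<eta> \<le> e" "\<eta> \<le> 1" "\<eta> \<le> \<eta>0" using \<eta>0 e by (auto simp: \<eta>_def)
    have "(\<lambda>l. (1/3::real) ^ (l + 1)) \<longlonglongrightarrow> 0" by (rule LIMSEQ_ignore_initial_segment[OF LIMSEQ_realpow_zero]) auto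
    then have "\<forall>\<^sub>F l in sequentially. (1/3::real) ^ (l + 1) < \<eta>" using \<eta> by (intro order_tendstoD) auto
    then show ?thesis
    proof eventually_elim
      case (elim l)
      interpret ncf R b "l + 1" "ncf_rem (\<alpha> (l + 1))" "ncf_digit (\<alpha> (l + 1))" by (rule ncf) simp
      have "rho (\<alpha> (l + 1)) \<le> ereal (((R - 2) / 4 + e) / (lam - b - 2 * \<eta>))"
        using rho_upper[of \<eta> e M] elim \<eta> e cov by auto
      also have "((R - 2) / 4 + e) / (lam - b - 2 * \<eta>) \<le> C + e"
      proof -
        have w: "lam - b \<ge> 4" using lam_eq R b_le by simp
        have C4: "(R - 2) / 4 = C * (lam - b)" 
        proof -
          have "1 / 4 * (r / w) * w = r / 4" if "w \<noteq> 0" for r w :: real using that by simp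
          from this[of "z + 1" "R - 2"] show ?thesis unfolding C1 W of_int_diff of_int_numeral using z0 by argo
        qed
        \<comment> \<open>With \<open>C \<le> 1/4\<close>, \<open>\<eta> \<le> e\<close> and
          \<open>lam - b \<ge> 4\<close>, the term \<open>e * (lam - b)\<close> absorbs the changes
          of numerator and denominator.\<close>
        have "C * (lam - b) \<le> 1/4 * (lam - b)" using C4 lam_eq b_le by simp
        then have "C \<le> 1/4" using w by simp
        then have "2 * \<eta> * C \<le> 2 * \<eta> * (1/4)" using \<eta> by (intro mult_left_mono) auto
        moreover have "e * 4 \<le> e * (lam - b)" "e * (2 * \<eta>) \<le> e * 2" using e w \<eta> by (auto intro!: mult_left_mono)
        moreover have "(C + e) * (lam - b - 2 * \<eta>) = C * (lam - b) + e * (lam - b) - 2 * \<eta> * C - e * (2 * \<eta>)"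
          by (simp add: algebra_simps)
        ultimately have "(R - 2) / 4 + e \<le> (C + e) * (lam - b - 2 * \<eta>)" using \<eta> C4 by linarith
        then show ?thesis using w \<eta> by (simp add: divide_le_eq)
      qed
      finally show ?case by simp
    qed
  qed
  have lower: "\<forall>\<^sub>F l in sequentially. ereal (C - e) \<le> rho (\<alpha> (l + 1))" if e: "0 < e" for e
  proof -
    have K0: "K > 0"
    proof -
      have "b\<^sup>2 \<le> b" using b_pos b_less by (simp add: power2_eq_square mult_left_le)
      then show ?thesis unfolding K_def using b_less by (intro divide_pos_pos) auto
    qed
    have "(\<lambda>l. b ^ (l + 1)) \<longlonglongrightarrow> 0" using b_pos b_less
      by (intro LIMSEQ_ignore_initial_segment[OF LIMSEQ_realpow_zero]) auto
    then have "\<forall>\<^sub>F l in sequentially. b ^ (l + 1) < min (K / 4) (e / 2)" using K0 e by (intro order_tendstoD) auto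
    then show ?thesis
    proof eventually_elim
      case (elim l)
      interpret N: ncf R b "l + 1" "ncf_rem (\<alpha> (l + 1))" "ncf_digit (\<alpha> (l + 1))" by (rule ncf) simp
      have K: "N.K = K" unfolding N.K_def K_def ..
      have "ereal (K / 4 - b ^ (l + 1) - e / 2) \<le> rho (\<alpha> (l + 1))"
        using N.rho_lower[of "e / 2"] elim e unfolding K by simp
      moreover have "ereal (C - e) \<le> ereal (K / 4 - b ^ (l + 1) - e / 2)" using elim by (simp add: C_def)
      ultimately show ?case by (rule order_trans[rotated])
    qed
  qed
  have "(\<lambda>l. rho (\<alpha> (l + 1))) \<longlonglongrightarrow> ereal C"
  proof (rule order_tendstoI)
    fix x assume "x < ereal C"
    then obtain r where r: "x < ereal r" "ereal r < ereal C" using ereal_dense2 by blast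
    show "\<forall>\<^sub>F l in sequentially. x < rho (\<alpha> (l + 1))"
      using lower[of "C - r"] r by (auto elim!: eventually_mono intro: less_le_trans)
  next
    fix x assume "ereal C < x"
    then obtain r where r: "ereal C < ereal r" "ereal r < x" using ereal_dense2 by blast
    show "\<forall>\<^sub>F l in sequentially. rho (\<alpha> (l + 1)) < x"
      using upper[of "r - C"] r by (auto elim!: eventually_mono intro: le_less_trans)
  qed
  then show ?thesis unfolding Let_def unfolding b_def[symmetric] unfolding C2[symmetric] z_def[symmetric]
    using C1 by blast
qed

end
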